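(* Let $A$ be a separable C*-algebra, let $B\subseteq A$ be a closed *-subalgebra containing an approximate unit for $A$, let $P:A\to B$ be a conditional expectation, and let $M$ be a slice. Let $R(M)$ be the closed linear span of $MM^*=\{mn^*:m,n\in M\}$, a closed two-sided ideal of $B$. Then there exists a unique central positive element $\tau$ in the multiplier algebra of $R(M)$ such that $\|\tau\|\le 1$ and $$\tau\, mn^*=P(m)P(n^* )\qquad\text{for all } m,n\in M.$$ Moreover, if $\{u_i\}_{i\in\mathbb N}$ is any frame for $M$, then $\tau=\sum_{i\in\mathbb N}P(u_i)P(u_i^* )$, the series being unconditionally convergent in the strict topology of the multiplier algebra of $R(M)$.
   Context: The normalizer of $B$ in $A$ is $N(B)=\{a\in A: a^*Ba\subseteq B,\ aBa^*\subseteq B\}$. A slice is a closed linear subspace $M\subseteq A$ with $M\subseteq N(B)$, $BM\subseteq M$ and $MB\subseteq M$; for a slice one has $MM^*\subseteq B$ and $M^*M\subseteq B$. A frame for a slice $M$ is a countable family $\{u_i\}_{i\in\mathbb N}$ of elements of $M$ such that $m=\sum_{i\in\mathbb N}u_iu_i^*m$ for every $m\in M$, the sum converging unconditionally in norm. (It is a fact that $P(M)\subseteq R(M)$ and $P(M^* )\subseteq R(M)$.) *)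

theory Defs
  imports "HOL-Analysis.Analysis"
begin

section \<open>C*-algebras\<close>

text \<open>A C*-algebra is a whole type; it is not assumed to be unital (or nonzero). Completeness
  comes from \<^class>\<open>banach\<close>, submultiplicativity of the norm from \<^class>\<open>real_normed_algebra\<close>.\<close>

class cstar_algebra = real_normed_algebra + banach +
  fixes scaleC :: "complex \<Rightarrow> 'a \<Rightarrow> 'a"  (infixr "*\<^sub>C" 75)
    and adj :: "'a \<Rightarrow> 'a"
  assumes scaleR_scaleC: "scaleR r x = complex_of_real r *\<^sub>C x"
    and scaleC_add_right: "c *\<^sub>C (x + y) = c *\<^sub>C x + c *\<^sub>C y"
    and scaleC_add_left: "(c + d) *\<^sub>C x = c *\<^sub>C x + d *\<^sub>C x"
    and scaleC_scaleC: "c *\<^sub>C d *\<^sub>C x = (c * d) *\<^sub>C x"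
    and mult_scaleC_left: "(c *\<^sub>C x) * y = c *\<^sub>C (x * y)"
    and mult_scaleC_right: "x * (c *\<^sub>C y) = c *\<^sub>C (x * y)"
    and norm_scaleC: "norm (c *\<^sub>C x) = cmod c * norm x"
    and adj_add: "adj (x + y) = adj x + adj y"
    and adj_scaleC: "adj (c *\<^sub>C x) = cnj c *\<^sub>C adj x"
    and adj_mult: "adj (x * y) = adj y * adj x"
    and adj_adj: "adj (adj x) = x"
    and cstar_identity: "norm (adj x * x) = (norm x)\<^sup>2"

lemma scaleC_one: "1 *\<^sub>C (x :: 'a::cstar_algebra) = x"
  using scaleR_scaleC[of 1 x] by simp

global_interpretation complex_vector: vector_space "scaleC :: complex \<Rightarrow> 'a \<Rightarrow> 'a::cstar_algebra"
  defines csubspace = complex_vector.subspace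
    and cspan = complex_vector.span
  by unfold_locales
    (simp_all add: scaleC_add_right scaleC_add_left scaleC_scaleC scaleC_one)

definition positive :: "'a::cstar_algebra \<Rightarrow> bool" where
  "positive a \<longleftrightarrow> (\<exists>c. a = adj c * c)"

definition closed_star_subalgebra :: "'a::cstar_algebra set \<Rightarrow> bool" where
  "closed_star_subalgebra B \<longleftrightarrow> closed B \<and> csubspace B \<and>
     (\<forall>x\<in>B. \<forall>y\<in>B. x * y \<in> B) \<and> (\<forall>x\<in>B. adj x \<in> B)"

text \<open>The approximate unit is a net of positive contractions, encoded by the (proper) filter on
  the algebra generated by the tails of the net; every proper filter arises from some net.\<close>

definition contains_approximate_unit :: "'a::cstar_algebra set \<Rightarrow> bool" where
  "contains_approximate_unit B \<longleftrightarrow>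
     (\<exists>F :: 'a filter. F \<noteq> bot \<and>
        (\<forall>\<^sub>F e in F. e \<in> B \<and> positive e \<and> norm e \<le> 1) \<and>
        (\<forall>a. ((\<lambda>e. e * a) \<longlongrightarrow> a) F \<and> ((\<lambda>e. a * e) \<longlongrightarrow> a) F))"

definition conditional_expectation :: "'a::cstar_algebra set \<Rightarrow> ('a \<Rightarrow> 'a) \<Rightarrow> bool" where
  "conditional_expectation B P \<longleftrightarrow>
     Vector_Spaces.linear scaleC scaleC P \<and>
     range P \<subseteq> B \<and> (\<forall>b\<in>B. P b = b) \<and>
     (\<forall>b\<in>B. \<forall>a. P (b * a) = b * P a \<and> P (a * b) = P a * b) \<and>
     (\<forall>a. positive a \<longrightarrow> positive (P a)) \<and>
     (\<forall>a. norm (P a) \<le> norm a)"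

section \<open>Slices and frames\<close>

definition normalizer :: "'a::cstar_algebra set \<Rightarrow> 'a set" where
  "normalizer B = {a. \<forall>b\<in>B. adj a * b * a \<in> B \<and> a * b * adj a \<in> B}"

definition slice :: "'a::cstar_algebra set \<Rightarrow> 'a set \<Rightarrow> bool" where
  "slice B M \<longleftrightarrow> closed M \<and> csubspace M \<and> M \<subseteq> normalizer B \<and>
     (\<forall>b\<in>B. \<forall>m\<in>M. b * m \<in> M \<and> m * b \<in> M)"

definition slice_range :: "'a::cstar_algebra set \<Rightarrow> 'a set" where
  "slice_range M = closure (cspan {m * adj n | m n. m \<in> M \<and> n \<in> M})"

text \<open>\<^const>\<open>has_sum\<close> is convergence of the net of finite partial sums, which for a
  sequence is the same as unconditional convergence.\<close>

definition frame :: "'a::cstar_algebra set \<Rightarrow> (nat \<Rightarrow> 'a) \<Rightarrow> bool" where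
  "frame M u \<longleftrightarrow> range u \<subseteq> M \<and>
     (\<forall>m\<in>M. ((\<lambda>i. u i * adj (u i) * m) has_sum m) UNIV)"

section \<open>The multiplier algebra\<close>

text \<open>Double centralizers of a C*-algebra \<open>J\<close> that is given as a subset of the ambient type. The
  two maps are extensional, so that equality of double centralizers means agreement on \<open>J\<close>.\<close>

datatype 'a double_centralizer = DC (lmult: "'a \<Rightarrow> 'a") (rmult: "'a \<Rightarrow> 'a")

definition bounded_clinear_on :: "'a::cstar_algebra set \<Rightarrow> ('a \<Rightarrow> 'a) \<Rightarrow> bool" where
  "bounded_clinear_on J f \<longleftrightarrow>
     (\<forall>x\<in>J. \<forall>y\<in>J. f (x + y) = f x + f y) \<and>
     (\<forall>c. \<forall>x\<in>J. f (c *\<^sub>C x) = c *\<^sub>C f x) \<and>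
     (\<exists>K. \<forall>x\<in>J. norm (f x) \<le> K * norm x)"

definition multiplier_algebra :: "'a::cstar_algebra set \<Rightarrow> 'a double_centralizer set" where
  "multiplier_algebra J =
     {T. lmult T \<in> J \<rightarrow>\<^sub>E J \<and> rmult T \<in> J \<rightarrow>\<^sub>E J \<and>
         bounded_clinear_on J (lmult T) \<and> bounded_clinear_on J (rmult T) \<and>
         (\<forall>x\<in>J. \<forall>y\<in>J.
            lmult T (x * y) = lmult T x * y \<and>
            rmult T (x * y) = x * rmult T y \<and>
            rmult T x * y = x * lmult T y)}"

definition dc_mult ::
  "'a set \<Rightarrow> 'a double_centralizer \<Rightarrow> 'a double_centralizer \<Rightarrow> 'a double_centralizer" where
  "dc_mult J S T = DC (\<lambda>x\<in>J. lmult S (lmult T x)) (\<lambda>x\<in>J. rmult T (rmult S x))"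

definition dc_adj :: "'a::cstar_algebra set \<Rightarrow> 'a double_centralizer \<Rightarrow> 'a double_centralizer" where
  "dc_adj J T = DC (\<lambda>x\<in>J. adj (rmult T (adj x))) (\<lambda>x\<in>J. adj (lmult T (adj x)))"

definition dc_norm :: "'a::cstar_algebra set \<Rightarrow> 'a double_centralizer \<Rightarrow> real" where
  "dc_norm J T = (SUP x\<in>{x\<in>J. norm x \<le> 1}. norm (lmult T x))"

definition dc_central :: "'a::cstar_algebra set \<Rightarrow> 'a double_centralizer \<Rightarrow> bool" where
  "dc_central J T \<longleftrightarrow> (\<forall>S\<in>multiplier_algebra J. dc_mult J T S = dc_mult J S T)"

definition dc_positive :: "'a::cstar_algebra set \<Rightarrow> 'a double_centralizer \<Rightarrow> bool" where
  "dc_positive J T \<longleftrightarrow> (\<exists>S\<in>multiplier_algebra J. T = dc_mult J (dc_adj J S) S)"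

text \<open>The canonical embedding of \<open>J\<close> into its multiplier algebra.\<close>

definition dc_embed :: "'a::cstar_algebra set \<Rightarrow> 'a \<Rightarrow> 'a double_centralizer" where
  "dc_embed J b = DC (\<lambda>x\<in>J. b * x) (\<lambda>x\<in>J. x * b)"

text \<open>The locally convex topology given by the seminorms \<open>T \<mapsto> \<parallel>T a\<parallel>\<close> and
  \<open>T \<mapsto> \<parallel>a T\<parallel>\<close> for \<open>a \<in> J\<close>.\<close>

definition strict_topology :: "'a::cstar_algebra set \<Rightarrow> 'a double_centralizer topology" where
  "strict_topology J = topology_generated_by
     {{T \<in> multiplier_algebra J.
         norm (lmult T a - lmult S a) < e \<and> norm (rmult T a - rmult S a) < e} | S a e.
       S \<in> multiplier_algebra J \<and> a \<in> J \<and> e > 0}"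

end

theory Submission
  imports Defs
begin

text \<open>Since \<open>m n\<^sup>*\<close> and \<open>n\<^sup>* x\<close> lie in \<open>B\<close> for \<open>m, n, x \<in> M\<close>, the \<open>B\<close>-linearity of \<open>P\<close> gives
  \<open>P m P n\<^sup>* x y\<^sup>* = m n\<^sup>* P x P y\<^sup>*\<close>, so \<open>m n\<^sup>* \<mapsto> P m P n\<^sup>*\<close> is formally a centralizer \<open>\<tau>\<close>. No frame is
  needed to bound it: for \<open>c = \<Sum> x x\<^sup>*\<close> put \<open>\<tau> c = \<Sum> P x P x\<^sup>*\<close>; then \<open>c - \<tau> c = \<Sum> P ((x - P x) (x - P x)\<^sup>*) \<ge> 0\<close>,
  hence \<open>\<tau> c\<close> and \<open>c - \<tau> c\<close> are bounded by \<open>\<parallel>c\<parallel>\<close>. Because \<open>\<tau>(z) c = z \<tau>(c)\<close> and such \<open>c\<close> with \<open>\<parallel>c\<parallel> \<le> 1\<close>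
  approximate a unit of \<open>R(M)\<close>, both \<open>\<tau>\<close> and \<open>1 - \<tau>\<close> are contractions. The binomial series of
  \<open>(1 - (1 - \<tau>))\<^sup>1\<^sup>/\<^sup>2\<close> is then a square root of \<open>\<tau>\<close>. For a frame, the partial sums of \<open>\<Sum> u\<^sub>i u\<^sub>i\<^sup>*\<close> are
  contractions converging strictly to \<open>1\<close>, and \<open>\<tau>\<close> maps them to those of \<open>\<Sum> P u\<^sub>i P u\<^sub>i\<^sup>*\<close>.\<close>

section \<open>The binomial series of the square root\<close>

text \<open>A product \<open>m * adj n\<close> does not determine its factors, and existence of the
  multiplier must not presuppose a frame; the bound therefore has to come from positivity. The order
  estimate is available only on sums of \<open>x * adj x\<close> with \<open>x\<close> in
  \<open>M\<close>, so the approximate unit of the ideal must consist of such sums. A polynomial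
  iteration produces them without inverses. Its origin is the Newton-Schulz iteration y (3 - y^2) /
  2 for the sign function: for d = y^2 it reads d (3 - d)^2 / 4, which increases to 1 when started
  in (0, 1]. All positivity rests on a single series. The coefficients of sqrt(1 - t) are absolutely
  summable at t = 1, so 1 - h has a root for every self-adjoint contraction h, with no appeal to
  spectra. The root commutes with whatever commutes with h, and this replaces functional calculus.
  Since the root of the multiplier is taken by the same series, the series is set up for linear
  contractions of a Banach space and not only for elements of an algebra.\<close>

definition sqrt_coeff :: "nat \<Rightarrow> real" where
  "sqrt_coeff k = (- 1) ^ k * ((1 / 2) gchoose k)"

lemma sqrt_coeff_0 [simp]: "sqrt_coeff 0 = 1"
  by (simp add: sqrt_coeff_def)

lemma sqrt_coeff_Suc:
  "sqrt_coeff (Suc k) = sqrt_coeff k * (real k - 1 / 2) / (real k + 1)"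
proof -
  have "(1 / 2 gchoose Suc k) * (real k + 1) = ((1 / 2 :: real) gchoose k) * (1 / 2 - real k)"
    using gbinomial_mult_1[of "1/2::real" k] by (simp add: algebra_simps)
  then have "(1 / 2 gchoose Suc k) = ((1 / 2 :: real) gchoose k) * (1 / 2 - real k) / (real k + 1)"
    by (simp add: field_simps)
  then have "sqrt_coeff (Suc k) = (- 1) ^ Suc k * (((1 / 2 :: real) gchoose k) * (1 / 2 - real k) / (real k + 1))"
    by (simp only: sqrt_coeff_def)
  then show ?thesis
    by (simp add: sqrt_coeff_def algebra_simps)
qed

lemma sqrt_coeff_nonpos: "k > 0 \<Longrightarrow> sqrt_coeff k \<le> 0"
proof (induction k rule: nat_induct_non_zero)
  case 1
  then show ?case using sqrt_coeff_Suc[of 0] by simp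
next
  case (Suc k)
  then show ?case
    by (simp add: sqrt_coeff_Suc divide_le_0_iff mult_le_0_iff)
qed

text \<open>This makes the sign of the partial sums at t = 1 visible: for positive \<open>n\<close>
  both factors are nonpositive.\<close>

lemma sum_sqrt_coeff: "(\<Sum>k\<le>n. sqrt_coeff k) = (1 - 2 * real n) * sqrt_coeff n"
proof (induction n)
  case (Suc n)
  have "sqrt_coeff (Suc n) * (real n + 1) = sqrt_coeff n * (real n - 1 / 2)"
    by (simp add: sqrt_coeff_Suc)
  with Suc show ?case by (simp add: algebra_simps)
qed simp

text \<open>Only the zeroth coefficient is positive, so the absolute sums are 2 minus the signed
  ones, which are nonnegative. Summability at the boundary point t = 1 is what admits operators of
  norm exactly one.\<close>

lemma sum_abs_sqrt_coeff_le: "(\<Sum>k<n. \<bar>sqrt_coeff k\<bar>) \<le> 2"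
proof -
  have "(\<Sum>k\<le>n. \<bar>sqrt_coeff k\<bar>) = 2 - (\<Sum>k\<le>n. sqrt_coeff k)" for n
    by (induction n) (simp_all add: abs_of_nonpos[OF sqrt_coeff_nonpos])
  moreover have "(\<Sum>k\<le>n. sqrt_coeff k) \<ge> 0"
    unfolding sum_sqrt_coeff
    by (cases "n = 0") (auto intro!: mult_nonpos_nonpos sqrt_coeff_nonpos)
  moreover have "(\<Sum>k<n. \<bar>sqrt_coeff k\<bar>) \<le> (\<Sum>k\<le>n. \<bar>sqrt_coeff k\<bar>)"
    by (rule sum_mono2) auto
  ultimately show ?thesis
    by (smt (verit))
qed

lemma summable_abs_sqrt_coeff: "summable (\<lambda>k. \<bar>sqrt_coeff k\<bar>)"
  by (rule summableI_nonneg_bounded[OF _ sum_abs_sqrt_coeff_le]) simp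

lemma suminf_abs_sqrt_coeff_Suc_le: "(\<Sum>k. \<bar>sqrt_coeff (Suc k)\<bar>) \<le> 1"
  using suminf_split_head[OF summable_abs_sqrt_coeff]
    suminf_le_const[OF summable_abs_sqrt_coeff sum_abs_sqrt_coeff_le] by simp

text \<open>The Cauchy square of the series of sqrt(1 - t) is 1 - t: Vandermonde adds the two
  exponents 1/2.\<close>

lemma sqrt_coeff_convolution:
  "(\<Sum>i\<le>n. sqrt_coeff i * sqrt_coeff (n - i)) = (if n = 0 then 1 else if n = 1 then - 1 else 0)"
proof -
  have "(\<Sum>i\<le>n. sqrt_coeff i * sqrt_coeff (n - i)) =
      (- 1) ^ n * (\<Sum>i\<le>n. ((1 / 2) gchoose i) * ((1 / 2) gchoose (n - i)))"
    by (auto simp: sqrt_coeff_def sum_distrib_left power_add[symmetric] intro!: sum.cong)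
  also have "\<dots> = (- 1) ^ n * ((1 :: real) gchoose n)"
    using gbinomial_Vandermonde[of "1/2::real" "1/2" n] by (simp add: atMost_atLeast0)
  also have "(1 :: real) gchoose n = (if n = 0 \<or> n = 1 then 1 else 0)"
    using binomial_gbinomial[of 1 n, where ?'a = real] by (cases "n > 1") (auto simp: binomial_eq_0)
  finally show ?thesis by auto
qed

text \<open>This is (1 - V)^(1/2) applied to x. Evaluating at a vector lets \<open>V\<close> be a
  plain function that is well behaved only on a subspace.\<close>

definition sqrt_series :: "('a::banach \<Rightarrow> 'a) \<Rightarrow> 'a \<Rightarrow> 'a" where
  "sqrt_series V x = (\<Sum>k. sqrt_coeff k *\<^sub>R (V ^^ k) x)"

text \<open>Interpreted twice: for left multiplication by a self-adjoint contraction on a whole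
  algebra, and for \<open>x - tau x\<close> on the range ideal, outside of which \<open>tau\<close>
  is unspecified.\<close>

locale contraction_on =
  fixes S :: "'a::banach set" and V :: "'a \<Rightarrow> 'a"
  assumes closed_S: "closed S" and subspace_S: "subspace S"
    and V_in: "x \<in> S \<Longrightarrow> V x \<in> S"
    and V_diff: "x \<in> S \<Longrightarrow> y \<in> S \<Longrightarrow> V (x - y) = V x - V y"
    and V_scaleR: "x \<in> S \<Longrightarrow> V (c *\<^sub>R x) = c *\<^sub>R V x"
    and V_norm: "x \<in> S \<Longrightarrow> norm (V x) \<le> norm x"
begin

lemma V_add: "x \<in> S \<Longrightarrow> y \<in> S \<Longrightarrow> V (x + y) = V x + V y"
  using V_diff[of x "- y"] V_scaleR[of y "-1"] subspace_neg[OF subspace_S, of y] by simp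

lemma pow_in: "x \<in> S \<Longrightarrow> (V ^^ k) x \<in> S"
  by (induction k) (auto intro: V_in)

lemma pow_norm: "x \<in> S \<Longrightarrow> norm ((V ^^ k) x) \<le> norm x"
  by (induction k) (auto intro: order_trans[OF V_norm] pow_in)

lemma pow_diff: "x \<in> S \<Longrightarrow> y \<in> S \<Longrightarrow> (V ^^ k) (x - y) = (V ^^ k) x - (V ^^ k) y"
  by (induction k) (auto simp: V_diff pow_in)

lemma pow_add: "x \<in> S \<Longrightarrow> y \<in> S \<Longrightarrow> (V ^^ k) (x + y) = (V ^^ k) x + (V ^^ k) y"
  by (induction k) (auto simp: V_add pow_in)

lemma pow_scaleR: "x \<in> S \<Longrightarrow> (V ^^ k) (c *\<^sub>R x) = c *\<^sub>R (V ^^ k) x"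
  by (induction k) (auto simp: V_scaleR pow_in)

lemma pow_sum:
  "finite I \<Longrightarrow> (\<And>i. i \<in> I \<Longrightarrow> f i \<in> S) \<Longrightarrow> (V ^^ k) (\<Sum>i\<in>I. f i) = (\<Sum>i\<in>I. (V ^^ k) (f i))"
proof (induction I rule: finite_induct)
  case empty
  then show ?case using pow_scaleR[of 0 k 0] subspace_0[OF subspace_S] by simp
next
  case (insert i I)
  then show ?case using subspace_sum[OF subspace_S, of I f] by (simp add: pow_add)
qed

lemma series_norm_le:
  "x \<in> S \<Longrightarrow> norm (sqrt_coeff k *\<^sub>R (V ^^ k) x) \<le> \<bar>sqrt_coeff k\<bar> * norm x"
  using mult_left_mono[OF pow_norm, of x "\<bar>sqrt_coeff k\<bar>" k] by simp

lemma summable_norm_series: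
  assumes "x \<in> S"
  shows "summable (\<lambda>k. norm (sqrt_coeff k *\<^sub>R (V ^^ k) x))"
  using summable_mult2[OF summable_abs_sqrt_coeff, of "norm x"]
  by (rule summable_comparison_test'[where N = 0]) (use series_norm_le[OF assms] in simp)

lemma sums_series: "x \<in> S \<Longrightarrow> (\<lambda>k. sqrt_coeff k *\<^sub>R (V ^^ k) x) sums sqrt_series V x"
  unfolding sqrt_series_def by (rule summable_sums, rule summable_norm_cancel, rule summable_norm_series)

lemma sqrt_series_in:
  assumes "x \<in> S"
  shows "sqrt_series V x \<in> S"
proof (rule closed_sequentially[OF closed_S])
  show "(\<lambda>n. \<Sum>k<n. sqrt_coeff k *\<^sub>R (V ^^ k) x) \<longlonglongrightarrow> sqrt_series V x"
    using sums_series[OF assms] by (simp add: sums_def)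
  show "(\<Sum>k<n. sqrt_coeff k *\<^sub>R (V ^^ k) x) \<in> S" for n
    by (intro subspace_sum[OF subspace_S] subspace_scale[OF subspace_S] pow_in assms)
qed

lemma sqrt_series_norm:
  assumes "x \<in> S"
  shows "norm (sqrt_series V x) \<le> (\<Sum>k. \<bar>sqrt_coeff k\<bar>) * norm x"
proof -
  have "norm (sqrt_series V x) \<le> (\<Sum>k. norm (sqrt_coeff k *\<^sub>R (V ^^ k) x))"
    unfolding sqrt_series_def by (rule summable_norm[OF summable_norm_series[OF assms]])
  also have "\<dots> \<le> (\<Sum>k. \<bar>sqrt_coeff k\<bar> * norm x)"
    by (intro suminf_le series_norm_le assms summable_norm_series summable_mult2 summable_abs_sqrt_coeff)
  finally show ?thesis
    by (simp add: suminf_mult2[OF summable_abs_sqrt_coeff])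
qed

text \<open>The difference is minus the tail of the series, whose coefficients sum absolutely to at
  most 1. This puts the root of an element into the unit ball around 1, so the root is again
  positive.\<close>

lemma norm_diff_sqrt_series_le:
  assumes "x \<in> S"
  shows "norm (x - sqrt_series V x) \<le> norm x"
proof -
  let ?f = "\<lambda>k. sqrt_coeff k *\<^sub>R (V ^^ k) x"
  have sf: "summable (\<lambda>k. norm (?f (Suc k)))"
    by (rule iffD2[OF summable_Suc_iff summable_norm_series[OF assms]])
  have sa: "summable (\<lambda>k. \<bar>sqrt_coeff (Suc k)\<bar>)"
    by (rule iffD2[OF summable_Suc_iff summable_abs_sqrt_coeff])
  have "x - sqrt_series V x = - (\<Sum>k. ?f (Suc k))"
    using suminf_split_head[OF summable_norm_cancel[OF summable_norm_series[OF assms]]]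
    by (simp add: sqrt_series_def)
  then have "norm (x - sqrt_series V x) \<le> (\<Sum>k. norm (?f (Suc k)))"
    using summable_norm[OF sf] by simp
  also have "\<dots> \<le> (\<Sum>k. \<bar>sqrt_coeff (Suc k)\<bar> * norm x)"
    by (intro suminf_le series_norm_le assms sf summable_mult2 sa)
  also have "\<dots> \<le> 1 * norm x"
    unfolding suminf_mult2[OF sa, symmetric]
    by (intro mult_right_mono suminf_abs_sqrt_coeff_Suc_le) simp
  finally show ?thesis by simp
qed

lemma sqrt_series_add:
  "x \<in> S \<Longrightarrow> y \<in> S \<Longrightarrow> sqrt_series V (x + y) = sqrt_series V x + sqrt_series V y"
  using sums_add[OF sums_series[of x] sums_series[of y]]
    sums_series[OF subspace_add[OF subspace_S, of x y]]
  by (auto simp: pow_add scaleR_add_right intro: sums_unique2)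

text \<open>\<open>W\<close> is required to be only real linear, so that besides multiplications and
  complex scalars it may be the conjugate-linear \<open>adj\<close>.\<close>

lemma sqrt_series_commute:
  assumes W: "bounded_linear W" and "\<And>x. x \<in> S \<Longrightarrow> W x \<in> S" "\<And>x. x \<in> S \<Longrightarrow> W (V x) = V (W x)"
    and x: "x \<in> S"
  shows "W (sqrt_series V x) = sqrt_series V (W x)"
proof -
  interpret W: bounded_linear W by fact
  have "W ((V ^^ k) x) = (V ^^ k) (W x)" for k
    by (induction k) (auto simp: assms pow_in)
  then have "(\<lambda>k. sqrt_coeff k *\<^sub>R (V ^^ k) (W x)) sums W (sqrt_series V x)"
    using W.sums[OF sums_series[OF x]] by (simp add: W.scaleR)
  then show ?thesis
    using sums_series[of "W x"] x assms(2) by (auto intro: sums_unique2)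
qed

text \<open>\<open>V\<close> is linear only on \<open>S\<close>, so powers of \<open>V\<close> are
  moved into the series by the contraction estimate on the partial sums instead of a continuity rule
  for bounded linear maps.\<close>

lemma sums_pow_series:
  assumes "x \<in> S"
  shows "(\<lambda>j. sqrt_coeff j *\<^sub>R (V ^^ (i + j)) x) sums (V ^^ i) (sqrt_series V x)"
  unfolding sums_def
proof (rule Lim_transform2)
  let ?p = "\<lambda>n. \<Sum>k<n. sqrt_coeff k *\<^sub>R (V ^^ k) x"
  have p: "?p n \<in> S" for n
    by (intro subspace_sum[OF subspace_S] subspace_scale[OF subspace_S] pow_in assms)
  have eq: "(\<Sum>j<n. sqrt_coeff j *\<^sub>R (V ^^ (i + j)) x) = (V ^^ i) (?p n)" for n
    by (subst pow_sum)
      (auto simp: funpow_add pow_scaleR pow_in assms intro!: subspace_scale[OF subspace_S])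
  have lim: "?p \<longlonglongrightarrow> sqrt_series V x"
    using sums_series[OF assms] by (simp add: sums_def)
  show "(\<lambda>n. (V ^^ i) (sqrt_series V x) - (\<Sum>j<n. sqrt_coeff j *\<^sub>R (V ^^ (i + j)) x)) \<longlonglongrightarrow> 0"
  proof (rule Lim_null_comparison)
    show "\<forall>\<^sub>F n in sequentially. norm ((V ^^ i) (sqrt_series V x) - (\<Sum>j<n. sqrt_coeff j *\<^sub>R (V ^^ (i + j)) x))
        \<le> norm (sqrt_series V x - ?p n)"
      unfolding eq pow_diff[OF sqrt_series_in[OF assms] p, symmetric]
      by (intro always_eventually allI pow_norm subspace_diff[OF subspace_S] sqrt_series_in assms p)
    show "(\<lambda>n. norm (sqrt_series V x - ?p n)) \<longlonglongrightarrow> 0"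
      using tendsto_diff[OF tendsto_const lim, of "sqrt_series V x"] by (simp add: tendsto_norm_zero)
  qed
qed simp

text \<open>A Cauchy product: the double family is dominated by the products of the absolute
  coefficients, so it may be summed by rows, giving the iterated series, or by diagonals.\<close>

lemma sqrt_series_sqrt_series:
  assumes x: "x \<in> S"
  shows "sqrt_series V (sqrt_series V x) = x - V x"
proof -
  define f where "f i j = (sqrt_coeff i * sqrt_coeff j) *\<^sub>R (V ^^ (i + j)) x" for i j
  define y where "y = sqrt_series V x"
  have f_le: "norm (f i j) \<le> \<bar>sqrt_coeff i\<bar> * \<bar>sqrt_coeff j\<bar> * norm x" for i j
    by (auto simp: f_def abs_mult intro!: mult_left_mono pow_norm x)
  have abs: "((\<lambda>i. \<bar>sqrt_coeff i\<bar>) has_sum (\<Sum>k. \<bar>sqrt_coeff k\<bar>)) UNIV"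
    using summable_sums[OF summable_abs_sqrt_coeff] summable_abs_sqrt_coeff
    by (intro norm_summable_imp_has_sum) simp_all
  have "(\<lambda>(i, j). \<bar>sqrt_coeff i\<bar> * \<bar>sqrt_coeff j\<bar> * norm x) summable_on UNIV \<times> UNIV"
  proof (rule summable_on_SigmaI)
    show "((\<lambda>j. (case (i, j) of (i, j) \<Rightarrow> \<bar>sqrt_coeff i\<bar> * \<bar>sqrt_coeff j\<bar> * norm x)) has_sum
        \<bar>sqrt_coeff i\<bar> * (\<Sum>k. \<bar>sqrt_coeff k\<bar>) * norm x) UNIV" for i
      using has_sum_cmult_left[OF has_sum_cmult_right[OF abs]] by simp
    show "(\<lambda>i. \<bar>sqrt_coeff i\<bar> * (\<Sum>k. \<bar>sqrt_coeff k\<bar>) * norm x) summable_on UNIV"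
      using abs by (intro summable_on_cmult_left) (auto simp: summable_on_def)
  qed auto
  then have sf: "(\<lambda>(i, j). f i j) summable_on UNIV \<times> UNIV"
    by (rule abs_summable_summable[OF summable_on_comparison_test]) (auto simp: f_le)
  have s1: "infsum (f i) UNIV = sqrt_coeff i *\<^sub>R (V ^^ i) y" for i
  proof -
    have "f i sums (sqrt_coeff i *\<^sub>R (V ^^ i) y)"
      using sums_scaleR_right[OF sums_pow_series[OF x]] by (simp add: f_def[abs_def] y_def)
    moreover have "summable (\<lambda>j. norm (f i j))"
      using summable_mult[OF summable_abs_sqrt_coeff, of "\<bar>sqrt_coeff i\<bar> * norm x"]
      by (rule summable_comparison_test'[where N = 0]) (use f_le[of i] in \<open>simp add: mult_ac\<close>)
    ultimately show ?thesis
      by (intro infsumI norm_summable_imp_has_sum)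
  qed
  have y: "y \<in> S"
    unfolding y_def by (rule sqrt_series_in[OF x])
  have "sqrt_series V y = infsum (\<lambda>i. sqrt_coeff i *\<^sub>R (V ^^ i) y) UNIV"
    by (rule infsumI[symmetric], rule norm_summable_imp_has_sum[OF summable_norm_series[OF y] sums_series[OF y]])
  also have "\<dots> = infsum (\<lambda>(i, j). f i j) (UNIV \<times> UNIV)"
    using infsum_Sigma'_banach[OF sf] by (simp add: s1)
  \<comment> \<open>Regrouping by the total degree n = i + j; each diagonal carries a single power
    of \<open>V\<close>, with the convolution as its coefficient.\<close>
  also have "\<dots> = infsum (\<lambda>(n, i). f i (n - i)) (SIGMA n:UNIV. {..n})"
    by (rule infsum_reindex_bij_witness[where i = "\<lambda>(n, i). (i, n - i)" and j = "\<lambda>(i, j). (i + j, i)"]) auto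
  also have "\<dots> = infsum (\<lambda>n. infsum (\<lambda>i. f i (n - i)) {..n}) UNIV"
  proof (rule infsum_Sigma'_banach[symmetric])
    show "(\<lambda>(n, i). f i (n - i)) summable_on (SIGMA n:UNIV. {..n})"
      using sf
      by (subst summable_on_reindex_bij_witness[where j = "\<lambda>(n, i). (i, n - i)" and i = "\<lambda>(i, j). (i + j, i)"
          and h = "\<lambda>(i, j). f i j" and T = "UNIV \<times> UNIV"]) auto
  qed
  also have "\<dots> = infsum (\<lambda>n. (if n = 0 then 1 else if n = 1 then - 1 else 0) *\<^sub>R (V ^^ n) x) UNIV"
    by (rule infsum_cong)
      (simp add: f_def scaleR_sum_left[symmetric] sqrt_coeff_convolution)
  also have "\<dots> = infsum (\<lambda>n. (if n = 0 then 1 else if n = 1 then - 1 else 0) *\<^sub>R (V ^^ n) x) {0, 1}"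
    by (rule infsum_cong_neutral) auto
  also have "\<dots> = x - V x"
    by simp
  finally show ?thesis by (simp add: y_def)
qed

end

section \<open>Positive elements of unital C*-algebras\<close>

lemma scaleC_minus1: "(- 1) *\<^sub>C (x::'a::cstar_algebra) = - x"
  by (metis complex_vector.scale_minus_left scaleC_one)

lemma bounded_linear_scaleC: "bounded_linear (\<lambda>x::'a::cstar_algebra. c *\<^sub>C x)"
  by (rule bounded_linear_intro[where K = "cmod c"])
    (simp_all add: scaleC_add_right scaleR_scaleC scaleC_scaleC mult.commute norm_scaleC)

lemma adj_0 [simp]: "adj (0::'a::cstar_algebra) = 0"
  using adj_add[of "0::'a" 0] by simp

lemma adj_minus: "adj (- x::'a::cstar_algebra) = - adj x"
  using adj_add[of x "- x"] by (simp add: eq_neg_iff_add_eq_0 add.commute)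

lemma adj_diff: "adj (x - y::'a::cstar_algebra) = adj x - adj y"
  using adj_add[of x "- y"] by (simp add: adj_minus)

lemma adj_scaleR: "adj (r *\<^sub>R x::'a::cstar_algebra) = r *\<^sub>R adj x"
  by (simp add: scaleR_scaleC adj_scaleC)

lemma norm_mult_adj: "norm (x * adj x :: 'a::cstar_algebra) = (norm (adj x))\<^sup>2"
  using cstar_identity[of "adj x"] by (simp add: adj_adj)

lemma norm_adj [simp]: "norm (adj x :: 'a::cstar_algebra) = norm x"
proof -
  have "norm y \<le> norm (adj y)" for y :: 'a
  proof (cases "y = 0")
    case False
    have "norm y * norm y \<le> norm (adj y) * norm y"
      using cstar_identity[of y] norm_mult_ineq[of "adj y" y] by (simp add: power2_eq_square)
    then show ?thesis using False by simp
  qed simp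
  from this[of x] this[of "adj x"] show ?thesis by (simp add: adj_adj)
qed

lemma bounded_linear_adj: "bounded_linear (adj :: 'a::cstar_algebra \<Rightarrow> 'a)"
  by (rule bounded_linear_intro[where K = 1]) (simp_all add: adj_add adj_scaleR)

lemmas tendsto_adj [tendsto_intros] = bounded_linear.tendsto[OF bounded_linear_adj]

lemma norm_square_selfadjoint:
  "adj s = s \<Longrightarrow> norm (s * s :: 'a::cstar_algebra) = (norm s)\<^sup>2"
  using cstar_identity[of s] by simp

lemma adj_mult_self_eq_0D: "adj x * x = 0 \<Longrightarrow> (x::'a::cstar_algebra) = 0"
  using cstar_identity[of x] by simp

lemma adj_sum: "adj (\<Sum>i\<in>I. f i :: 'a::cstar_algebra) = (\<Sum>i\<in>I. adj (f i))"
  by (induction I rule: infinite_finite_induct) (simp_all add: adj_add)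

text \<open>Not \<^class>\<open>ring_1\<close>, which requires \<open>0 \<noteq> 1\<close>: the algebra of operators on the zero algebra is zero.\<close>

class unital_cstar_algebra = cstar_algebra + monoid_mult

lemma adj_1 [simp]: "adj (1::'a::unital_cstar_algebra) = 1"
  by (metis adj_adj adj_mult mult_1_left)

lemma norm_1_le: "norm (1::'a::unital_cstar_algebra) \<le> 1"
proof -
  have "norm (1::'a) * norm (1::'a) = norm (1::'a) * 1"
    using cstar_identity[of "1::'a"] by (simp add: power2_eq_square)
  then show ?thesis by (metis mult_cancel_left order_refl zero_le_one)
qed

lemma norm_mult_le_1:
  "norm a \<le> 1 \<Longrightarrow> norm b \<le> 1 \<Longrightarrow> norm (a * b :: 'a::real_normed_algebra) \<le> 1"
  using norm_mult_ineq[of a b] mult_mono[of "norm a" 1 "norm b" 1] by simp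

lemma mult_swap: "a * b = b * a \<Longrightarrow> a * (b * z) = b * (a * z :: 'a::semigroup_mult)"
  by (simp flip: mult.assoc)

text \<open>For self-adjoint \<open>a\<close> this says that the spectrum lies in [0, 2t]. In this
  metric form sums of positive elements are positive by the triangle inequality, and
  \<open>a / t\<close> is visibly 1 minus a contraction.\<close>

definition pos :: "'a::unital_cstar_algebra \<Rightarrow> bool" where
  "pos a \<longleftrightarrow> adj a = a \<and> (\<exists>t. norm (t *\<^sub>R 1 - a) \<le> t)"

lemma pos_selfadjoint: "pos a \<Longrightarrow> adj a = a"
  by (simp add: pos_def)

text \<open>The commutation clause is carried along because several roots are later multiplied with
  each other, and such products are self-adjoint only if the factors commute.\<close>

lemma sqrt_one_minus:
  fixes h :: "'a::unital_cstar_algebra"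
  assumes h: "adj h = h" "norm h \<le> 1"
  obtains s where "adj s = s" "norm (1 - s) \<le> 1" "s * s = 1 - h" "\<And>z. z * h = h * z \<Longrightarrow> z * s = s * z"
proof
  interpret contraction_on UNIV "\<lambda>x. h * x"
    by unfold_locales
      (auto simp: algebra_simps intro!: order_trans[OF norm_mult_ineq] mult_left_le_one_le h)
  let ?S = "sqrt_series (\<lambda>x. h * x)"
  \<comment> \<open>Right multiplications commute with left multiplication by \<open>h\<close>, so
    the operator \<open>?S\<close> is itself left multiplication by the element
    \<open>?S 1\<close>.\<close>
  have mult: "?S x * y = ?S (x * y)" for x y
    by (rule sqrt_series_commute[OF bounded_linear_mult_left]) (auto simp: mult.assoc)
  have pow: "((\<lambda>x. h * x) ^^ k) 1 = h ^ k" for k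
    by (induction k) auto
  have adj_pow: "adj (h ^ k) = h ^ k" for k
    by (induction k) (auto simp: adj_mult h power_commutes)
  have sums: "(\<lambda>k. sqrt_coeff k *\<^sub>R h ^ k) sums ?S 1"
    using sums_series[of 1] by (simp add: pow)
  have "(\<lambda>k. sqrt_coeff k *\<^sub>R h ^ k) sums adj (?S 1)"
    using bounded_linear.sums[OF bounded_linear_adj sums] by (simp add: adj_scaleR adj_pow)
  with sums show "adj (?S 1) = ?S 1"
    by (rule sums_unique2[symmetric])
  show "norm (1 - ?S 1) \<le> 1"
    using norm_diff_sqrt_series_le[of 1] norm_1_le order_trans by auto
  show "?S 1 * ?S 1 = 1 - h"
    using sqrt_series_sqrt_series[of 1] by (simp add: mult)
  show "z * ?S 1 = ?S 1 * z" if "z * h = h * z" for z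
    unfolding mult
    by (subst sqrt_series_commute[OF bounded_linear_mult_right])
      (auto simp: that mult.assoc[symmetric])
qed

text \<open>Rescaling to a = t (1 - h) with \<open>h\<close> a contraction; a vanishing
  \<open>t\<close> forces \<open>a = 0\<close>.\<close>

lemma pos_sqrt:
  fixes a :: "'a::unital_cstar_algebra"
  assumes "pos a"
  obtains s where "pos s" "s * s = a" "\<And>z. z * a = a * z \<Longrightarrow> z * s = s * z"
proof -
  obtain t where t: "norm (t *\<^sub>R 1 - a) \<le> t" and a: "adj a = a"
    using assms by (auto simp: pos_def)
  have "t \<ge> 0" using t norm_ge_zero order_trans by blast
  show ?thesis
  proof (cases "t = 0")
    case True
    then have "a = 0" using t by simp
    then show ?thesis by (intro that[of 0]) (auto simp: pos_def intro!: exI[of _ 0])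
  next
    case False
    then have "t > 0" using \<open>t \<ge> 0\<close> by simp
    define h where "h = 1 - (1 / t) *\<^sub>R a"
    have th: "t *\<^sub>R h = t *\<^sub>R 1 - a"
      using \<open>t > 0\<close> by (simp add: h_def scaleR_diff_right)
    have "t * norm h \<le> t * 1"
      using t \<open>t > 0\<close> by (simp add: th[symmetric])
    then have "norm h \<le> 1" using \<open>t > 0\<close> by simp
    moreover have "adj h = h" by (simp add: h_def adj_diff adj_scaleR a)
    ultimately obtain s where s: "adj s = s" "norm (1 - s) \<le> 1" "s * s = 1 - h"
      "\<And>z. z * h = h * z \<Longrightarrow> z * s = s * z"
      using sqrt_one_minus by blast
    show ?thesis
    proof (rule that[of "sqrt t *\<^sub>R s"])
      have "sqrt t *\<^sub>R 1 - sqrt t *\<^sub>R s = sqrt t *\<^sub>R (1 - s)"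
        by (simp add: scaleR_diff_right)
      then have "norm (sqrt t *\<^sub>R 1 - sqrt t *\<^sub>R s) = sqrt t * norm (1 - s)"
        using \<open>t > 0\<close> by simp
      also have "\<dots> \<le> sqrt t"
        using s(2) \<open>t > 0\<close> by simp
      finally show "pos (sqrt t *\<^sub>R s)"
        by (auto simp: pos_def adj_scaleR s(1))
      show "sqrt t *\<^sub>R s * sqrt t *\<^sub>R s = a"
        using \<open>t > 0\<close> by (simp add: s(3) h_def)
      show "z * sqrt t *\<^sub>R s = sqrt t *\<^sub>R s * z" if "z * a = a * z" for z
        using s(4)[of z] that by (simp add: h_def algebra_simps)
    qed
  qed
qed

text \<open>The element w = s + i r satisfies \<open>adj w * w = s * s + r * r\<close> because
  \<open>s\<close> and \<open>r\<close> commute, and \<open>s\<close> is the real part of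
  \<open>w\<close>.\<close>

lemma commuting_squares_bound:
  fixes s r :: "'a::unital_cstar_algebra"
  assumes "adj s = s" "adj r = r" "s * r = r * s" and sum: "s * s + r * r = t *\<^sub>R 1" and "t \<ge> 0"
  shows "(norm s)\<^sup>2 \<le> t"
proof -
  define w where "w = s + \<i> *\<^sub>C r"
  have adj_w: "adj w = s - \<i> *\<^sub>C r"
    by (simp add: w_def adj_add adj_scaleC assms)
  have "adj w * w = s * s + r * r"
    unfolding adj_w
    by (simp add: w_def algebra_simps mult_scaleC_left mult_scaleC_right scaleC_scaleC scaleC_minus1 assms(3))
  then have "(norm w)\<^sup>2 = norm (t *\<^sub>R (1::'a))"
    by (simp add: cstar_identity[symmetric] sum)
  also have "\<dots> \<le> t"
    using \<open>t \<ge> 0\<close> norm_1_le[where ?'a = 'a] by (simp add: mult_left_le)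
  finally have w: "(norm w)\<^sup>2 \<le> t" .
  have "2 *\<^sub>R s = w + adj w"
    unfolding adj_w by (simp add: w_def scaleR_2)
  then have "2 * norm s = norm (w + adj w)"
    by (metis norm_scaleR abs_numeral)
  also have "\<dots> \<le> 2 * norm w"
    using norm_triangle_ineq[of w "adj w"] by simp
  finally have "norm s \<le> norm w" by simp
  then have "(norm s)\<^sup>2 \<le> (norm w)\<^sup>2" by (rule power_mono) simp
  from this w show ?thesis by (rule order_trans)
qed

text \<open>The complement t - s^2 is positive for trivial reasons, being at distance at most t from
  t. Its root r commutes with s, and s^2 + r^2 = t bounds r in turn. Positivity of squares
  follows.\<close>

lemma norm_complement_square:
  fixes s :: "'a::unital_cstar_algebra"
  assumes s: "adj s = s" "(norm s)\<^sup>2 \<le> t"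
  shows "norm (t *\<^sub>R 1 - s * s) \<le> t"
proof -
  have "t \<ge> 0" using s(2) order_trans zero_le_power2 by blast
  have "pos (t *\<^sub>R 1 - s * s)"
    using s by (auto simp: pos_def adj_diff adj_scaleR adj_mult norm_square_selfadjoint intro!: exI[of _ t])
  then obtain r where r: "pos r" "r * r = t *\<^sub>R 1 - s * s"
    "\<And>z. z * (t *\<^sub>R 1 - s * s) = (t *\<^sub>R 1 - s * s) * z \<Longrightarrow> z * r = r * z"
    using pos_sqrt by blast
  have "s * r = r * s" by (rule r(3)) (simp add: algebra_simps)
  then have "(norm r)\<^sup>2 \<le> t"
    using r(1,2) s \<open>t \<ge> 0\<close> by (intro commuting_squares_bound[of r s]) (simp_all add: pos_selfadjoint)
  moreover have "norm (r * r) \<le> (norm r)\<^sup>2"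
    by (simp add: power2_eq_square norm_mult_ineq)
  ultimately show ?thesis using r(2) by simp
qed

lemma pos_square: "adj s = s \<Longrightarrow> pos (s * s)"
  using norm_complement_square[of s "(norm s)\<^sup>2"] by (auto simp: pos_def adj_mult)

text \<open>The definition of \<open>pos\<close> provides some \<open>t\<close>; this frees the
  choice to any bound of the norm.\<close>

lemma norm_complement_pos:
  assumes "pos a" "norm a \<le> t"
  shows "norm (t *\<^sub>R 1 - a) \<le> t"
proof -
  obtain s where "pos s" "s * s = a" using pos_sqrt[OF assms(1)] by blast
  then show ?thesis
    using norm_complement_square[of s t] assms(2) norm_square_selfadjoint[of s]
    by (auto simp: pos_selfadjoint)
qed

lemma pos_0 [simp]: "pos 0"
  using pos_square[of 0] by simp

lemma pos_add: "pos a \<Longrightarrow> pos b \<Longrightarrow> pos (a + b)"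
proof -
  assume "pos a" "pos b"
  then obtain t u where "norm (t *\<^sub>R 1 - a) \<le> t" "norm (u *\<^sub>R 1 - b) \<le> u"
    by (auto simp: pos_def)
  then have "norm ((t *\<^sub>R 1 - a) + (u *\<^sub>R 1 - b)) \<le> t + u"
    by (rule norm_triangle_mono)
  then have "norm ((t + u) *\<^sub>R 1 - (a + b)) \<le> t + u"
    by (simp add: algebra_simps)
  then show ?thesis using \<open>pos a\<close> \<open>pos b\<close> by (auto simp: pos_def adj_add)
qed

lemma pos_scaleR:
  assumes "pos a" "r \<ge> 0"
  shows "pos (r *\<^sub>R a)"
proof -
  obtain s where "pos s" "s * s = a" using pos_sqrt[OF assms(1)] by blast
  then have "pos ((sqrt r *\<^sub>R s) * (sqrt r *\<^sub>R s))"
    by (intro pos_square) (simp add: adj_scaleR pos_selfadjoint)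
  then show ?thesis using \<open>s * s = a\<close> \<open>r \<ge> 0\<close> by simp
qed

lemma pos_complement: "adj a = a \<Longrightarrow> norm a \<le> t \<Longrightarrow> pos (t *\<^sub>R 1 - a)"
  by (auto simp: pos_def adj_diff adj_scaleR intro!: exI[of _ t])

text \<open>The roots of \<open>a\<close> and of its complement commute, and their squares add up to
  \<open>t\<close>.\<close>

lemma norm_le_of_complement_pos:
  fixes a :: "'a::unital_cstar_algebra"
  assumes "pos a" "pos (t *\<^sub>R 1 - a)" "t \<ge> 0"
  shows "norm a \<le> t"
proof -
  obtain s where s: "pos s" "s * s = a" using pos_sqrt[OF assms(1)] by blast
  obtain r where r: "pos r" "r * r = t *\<^sub>R 1 - a"
    "\<And>z. z * (t *\<^sub>R 1 - a) = (t *\<^sub>R 1 - a) * z \<Longrightarrow> z * r = r * z"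
    using pos_sqrt[OF assms(2)] by blast
  have "s * r = r * s" by (rule r(3)) (simp add: algebra_simps s(2)[symmetric])
  then have "(norm s)\<^sup>2 \<le> t"
    using r(1,2) s \<open>t \<ge> 0\<close> by (intro commuting_squares_bound[of s r]) (simp_all add: pos_selfadjoint)
  then show ?thesis using norm_square_selfadjoint[of s] s by (simp add: pos_selfadjoint)
qed

text \<open>With N the norm of the sum, N - a is the sum of the positive elements N - (a + b) and
  b.\<close>

lemma pos_norm_mono:
  assumes "pos a" "pos b"
  shows "norm a \<le> norm (a + b)"
proof (rule norm_le_of_complement_pos[OF assms(1)])
  have "pos (norm (a + b) *\<^sub>R 1 - (a + b))"
    by (intro pos_complement) (simp_all add: adj_add pos_selfadjoint assms)
  from pos_add[OF this assms(2)] show "pos (norm (a + b) *\<^sub>R 1 - a)"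
    by simp
qed simp

text \<open>If \<open>y\<^sup>* y = - p\<^sup>2\<close>, then \<open>y y\<^sup>*\<close> is positive, since \<open>y\<^sup>* y + y y\<^sup>*\<close> is a sum of squares. As \<open>y\<close>
  intertwines \<open>y\<^sup>* y\<close> and \<open>y y\<^sup>*\<close>, comparing the norms of \<open>p\<^sup>2 (N + p\<^sup>2)\<^sup>2 = - y\<^sup>* (N - y y\<^sup>*)\<^sup>2 y\<close>
  for \<open>N = \<parallel>y\<parallel>\<^sup>2\<close> gives \<open>2 N\<^sup>3 \<le> N\<^sup>3\<close>.\<close>

lemma adj_mult_self_eq_neg_square:
  fixes y p :: "'a::unital_cstar_algebra"
  assumes p: "adj p = p" and y: "adj y * y = - (p * p)"
  shows "y = 0"
proof -
  define a b N where "a = y * adj y" and "b = p * p" and "N = (norm y)\<^sup>2"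
  have "pos b" unfolding b_def by (rule pos_square[OF p])
  have "adj b = b" using \<open>pos b\<close> by (rule pos_selfadjoint)
  define u v where "u = y + adj y" and "v = \<i> *\<^sub>C (y - adj y)"
  have "adj u = u" "adj v = v"
    by (simp_all add: u_def v_def adj_add adj_adj adj_diff adj_scaleC add.commute
      complex_vector.scale_right_diff_distrib)
  have "u * u + v * v = 2 *\<^sub>R (a - b)"
    unfolding u_def v_def a_def b_def
    using y by (simp add: algebra_simps mult_scaleC_left mult_scaleC_right scaleC_scaleC scaleC_minus1
      scaleR_2 complex_vector.scale_right_diff_distrib)
  then have "a = (1 / 2) *\<^sub>R (u * u) + (1 / 2) *\<^sub>R (v * v) + b"
    by (simp add: scaleR_add_right[symmetric])
  moreover have "pos ((1 / 2) *\<^sub>R (u * u) + (1 / 2) *\<^sub>R (v * v) + b)"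
    using \<open>adj u = u\<close> \<open>adj v = v\<close> \<open>pos b\<close> by (intro pos_add pos_scaleR pos_square) auto
  ultimately have "pos a" by simp
  have norm_a: "norm a = N" and norm_b: "norm b = N"
    using norm_mult_adj[of y] cstar_identity[of y] y by (simp_all add: a_def b_def N_def)
  have "y * b = - (a * y)"
    using arg_cong[OF y, of "\<lambda>z. y * z"] by (simp add: a_def b_def mult.assoc)
  then have y1: "y * (N *\<^sub>R 1 + b) = (N *\<^sub>R 1 - a) * y"
    by (simp add: algebra_simps)
  have "- (b * ((N *\<^sub>R 1 + b) * (N *\<^sub>R 1 + b))) = adj y * ((y * (N *\<^sub>R 1 + b)) * (N *\<^sub>R 1 + b))"
    using y by (simp add: b_def mult.assoc[symmetric])
  also have "\<dots> = adj y * ((N *\<^sub>R 1 - a) * ((N *\<^sub>R 1 - a) * y))"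
    by (simp only: y1 mult.assoc)
  finally have "norm (b * ((N *\<^sub>R 1 + b) * (N *\<^sub>R 1 + b))) =
      norm (adj y * ((N *\<^sub>R 1 - a) * ((N *\<^sub>R 1 - a) * y)))"
    by (metis norm_minus_cancel)
  also have "\<dots> \<le> norm (adj y) * (norm (N *\<^sub>R 1 - a) * (norm (N *\<^sub>R 1 - a) * norm y))"
    by (meson norm_ge_zero norm_mult_ineq mult_left_mono order_trans)
  also have "\<dots> \<le> norm y * (N * (N * norm y))"
    using norm_complement_pos[OF \<open>pos a\<close>, of N] norm_a norm_ge_zero[of a]
    by (simp add: mult_left_mono mult_mono)
  also have "\<dots> = N ^ 3"
    by (simp add: N_def power2_eq_square power3_eq_cube)
  finally have upper: "norm (b * ((N *\<^sub>R 1 + b) * (N *\<^sub>R 1 + b))) \<le> N ^ 3" .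
  have expand: "b * ((N *\<^sub>R 1 + b) * (N *\<^sub>R 1 + b)) = (2 * N) *\<^sub>R (b * b) + ((b * p) * (b * p) + (N * N) *\<^sub>R b)"
  proof -
    have "(b * p) * (b * p) = b * b * b"
      by (simp add: b_def mult.assoc)
    moreover have "(2 * N) *\<^sub>R (b * b) = N *\<^sub>R (b * b) + N *\<^sub>R (b * b)"
      by (simp flip: scaleR_left_distrib)
    ultimately show ?thesis by (simp add: algebra_simps)
  qed
  have "adj (b * p) = b * p"
    by (simp add: b_def adj_mult p mult.assoc)
  then have "norm ((2 * N) *\<^sub>R (b * b)) \<le> norm (b * ((N *\<^sub>R 1 + b) * (N *\<^sub>R 1 + b)))"
    unfolding expand using \<open>pos b\<close> \<open>adj b = b\<close>
    by (intro pos_norm_mono pos_add pos_scaleR pos_square) (auto simp: N_def)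
  also have "norm ((2 * N) *\<^sub>R (b * b)) = 2 * N ^ 3"
    using norm_square_selfadjoint[OF \<open>adj b = b\<close>] norm_b
    by (simp add: N_def power2_eq_square power3_eq_cube abs_mult)
  finally have "N ^ 3 \<le> 0" using upper by linarith
  then show "y = 0" by (simp add: N_def)
qed

text \<open>With k = |h|, the element n = |h| - h is twice the negative part of h, and h n = -|h| n.
  Hence \<open>adj (c * n) * (c * n)\<close> is minus the square of the self-adjoint element
  \<open>q * n\<close>, where q = |h|^(1/2). The preceding lemma gives \<open>c * n = 0\<close>, and
  then n vanishes, so that h = |h|.\<close>

lemma pos_adj_mult: "pos (adj c * c)"
proof -
  define h where "h = adj c * c"
  have h: "adj h = h" by (simp add: h_def adj_mult adj_adj)
  obtain k where k: "pos k" "k * k = h * h" "\<And>z. z * (h * h) = (h * h) * z \<Longrightarrow> z * k = k * z"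
    using pos_sqrt[OF pos_square[OF h]] by blast
  obtain q where q: "pos q" "q * q = k" "\<And>z. z * k = k * z \<Longrightarrow> z * q = q * z"
    using pos_sqrt[OF k(1)] by blast
  define n where "n = k - h"
  have kh: "h * k = k * h" by (rule k(3)) (simp add: mult.assoc)
  have n: "adj n = n" by (simp add: n_def adj_diff pos_selfadjoint k(1) h)
  have hn: "h * n = - (k * n)"
    by (simp add: n_def algebra_simps k(2) kh)
  have nq: "n * q = q * n"
    by (rule q(3)) (simp add: n_def algebra_simps kh)
  have "adj (c * n) * (c * n) = n * (h * n)"
    by (simp add: adj_mult n h_def mult.assoc)
  also have "\<dots> = - ((q * n) * (q * n))"
    by (simp add: hn q(2)[symmetric] mult.assoc nq mult_swap[OF nq])
  finally have "c * n = 0"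
    using q(1) n nq by (intro adj_mult_self_eq_neg_square[of "q * n"]) (auto simp: adj_mult pos_selfadjoint)
  then have "h * n = 0" by (simp add: h_def mult.assoc)
  then have "n * n = 0" using hn by (simp add: n_def left_diff_distrib)
  then have "n = 0" using adj_mult_self_eq_0D[of n] n by simp
  then show ?thesis using k(1) by (simp add: n_def h_def)
qed

lemma pos_mult_adj: "pos (c * adj c)"
  using pos_adj_mult[of "adj c"] by (simp add: adj_adj)

lemma pos_conj:
  assumes "pos a"
  shows "pos (g * a * adj g)"
proof -
  obtain s where s: "pos s" "s * s = a" using pos_sqrt[OF assms] by blast
  then have "g * a * adj g = (g * s) * adj (g * s)"
    by (simp add: adj_mult pos_selfadjoint mult.assoc s(2)[symmetric])
  then show ?thesis by (simp add: pos_mult_adj)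
qed

section \<open>A polynomial iteration approaching a unit\<close>

text \<open>The map \<open>t \<mapsto> t (3 - t)\<^sup>2 / 4\<close> sends \<open>[0, 1]\<close> to itself, satisfies
  \<open>1 - t (3 - t)\<^sup>2 / 4 = (1 - t)\<^sup>2 (1 - t / 4)\<close>, and is of the form \<open>g(t) t g(t)\<close>.\<close>

definition newton_step :: "'a::real_algebra \<Rightarrow> 'a" where
  "newton_step d = (9 / 4) *\<^sub>R d - (3 / 2) *\<^sub>R (d * d) + (1 / 4) *\<^sub>R (d * d * d)"

text \<open>The operator form of a Bernoulli inequality: (1 - d)^k (1 + k d) is at most 1 on [0, 1].
  Thus 1 is the sum of k d (1 - d)^k and positive remainders, and monotonicity of the norm
  applies.\<close>

lemma norm_mult_complement_power:
  fixes d :: "'a::unital_cstar_algebra"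
  assumes d: "pos d" "norm d \<le> 1"
  shows "real k * norm (d * (1 - d) ^ k) \<le> 1"
proof -
  define e where "e = 1 - d"
  have "pos e"
    using pos_complement[of d 1] d by (simp add: e_def pos_selfadjoint)
  have ed: "e * d = d * e" by (simp add: e_def algebra_simps)
  obtain s where s: "pos s" "s * s = d" "\<And>z. z * d = d * z \<Longrightarrow> z * s = s * z"
    using pos_sqrt[OF d(1)] by blast
  obtain r where r: "pos r" "r * r = e" "\<And>z. z * e = e * z \<Longrightarrow> z * r = r * z"
    using pos_sqrt[OF \<open>pos e\<close>] by blast
  have rd: "d * r = r * d" using r(3) ed by simp
  have rs: "r * s = s * r" using s(3)[of r] rd by simp
  have rk: "r ^ k * r ^ k = e ^ k" for k
    by (simp add: r(2)[symmetric] power_add[symmetric] mult_2[symmetric] power_mult power2_eq_square)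
  have rkd: "r ^ k * d = d * r ^ k" for k
    using power_commuting_commutes[of r d k] rd by simp
  have rks: "r ^ k * s = s * r ^ k" for k
    using power_commuting_commutes[of r s k] rs by simp
  have adj_r: "adj (r ^ k) = r ^ k" for k
    using r(1) by (induction k) (auto simp: adj_mult pos_selfadjoint power_commutes)
  have pos_e: "pos (e ^ k)" for k
    using pos_square[OF adj_r, of k] by (simp add: rk)
  have "(s * r ^ k) * (s * r ^ k) = d * e ^ k" for k
    by (simp add: mult.assoc mult_swap[OF rks] rk) (simp add: s(2) flip: mult.assoc)
  moreover have "pos ((s * r ^ k) * (s * r ^ k))" for k
    using s(1) by (intro pos_square) (simp add: adj_mult adj_r pos_selfadjoint rks)
  ultimately have pos_de: "pos (d * e ^ k)" for k by simp
  have "(d * r ^ k) * (d * r ^ k) = d * d * e ^ k" for k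
    by (simp add: mult.assoc mult_swap[OF rkd] rk)
  moreover have "pos ((d * r ^ k) * (d * r ^ k))" for k
    using d(1) by (intro pos_square) (simp add: adj_mult adj_r pos_selfadjoint rkd)
  ultimately have pos_dde: "pos (d * d * e ^ k)" for k by simp
  have "pos (1 - e ^ k - real k *\<^sub>R (d * e ^ k))" for k
  proof (induction k)
    case (Suc k)
    have e_eq: "e * x = x - d * x" for x by (simp add: e_def algebra_simps)
    \<comment> \<open>Raising the exponent adds exactly the positive term (k + 1) d^2 (1 -
      d)^k.\<close>
    have eq: "1 - e ^ Suc k - real (Suc k) *\<^sub>R (d * e ^ Suc k) =
        1 - e ^ k - real k *\<^sub>R (d * e ^ k) + real (Suc k) *\<^sub>R (d * d * e ^ k)"
      by (simp add: e_eq algebra_simps)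
    show ?case
      unfolding eq by (intro pos_add Suc pos_scaleR pos_dde) simp
  qed simp
  then have "norm (real k *\<^sub>R (d * e ^ k)) \<le>
      norm (real k *\<^sub>R (d * e ^ k) + ((1 - e ^ k - real k *\<^sub>R (d * e ^ k)) + e ^ k))"
    using pos_e pos_de by (intro pos_norm_mono pos_add pos_scaleR) auto
  then have "norm (real k *\<^sub>R (d * e ^ k)) \<le> 1"
    using norm_1_le[where ?'a = 'a] by simp
  then show ?thesis by (simp add: e_def)
qed

text \<open>A step squares 1 - D up to a contractive factor, so the exponent of 1 - d at least
  doubles. Keeping only the linear exponent \<open>Suc n\<close> is enough for convergence and lets
  the surplus be absorbed into \<open>k\<close>.\<close>

lemma newton_iteration:
  fixes d :: "'a::unital_cstar_algebra"
  assumes d: "pos d" "norm d \<le> 1"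
  defines "D \<equiv> \<lambda>n. (newton_step ^^ n) d"
  shows "pos (D n) \<and> norm (D n) \<le> 1 \<and> D n * d = d * D n \<and>
    (\<exists>k. norm k \<le> 1 \<and> k * d = d * k \<and> 1 - D n = (1 - d) ^ Suc n * k)"
proof (induction n)
  case 0
  then show ?case using d norm_1_le by (auto simp: D_def intro!: exI[of _ 1])
next
  case (Suc n)
  define x e where "x = D n" and "e = 1 - d"
  obtain k where k: "norm k \<le> 1" "k * d = d * k" "1 - x = e ^ Suc n * k"
    and x: "pos x" "norm x \<le> 1" "x * d = d * x"
    using Suc by (auto simp: x_def e_def)
  have DS: "D (Suc n) = newton_step x" by (simp add: D_def x_def)
  have adj_x: "adj x = x" by (rule pos_selfadjoint[OF x(1)])
  have complement: "1 - newton_step x = (1 - x) * (1 - x) * (1 - (1 / 4) *\<^sub>R x)"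
  proof -
    have "(9 / 4) *\<^sub>R x = 2 *\<^sub>R x + (1 / 4) *\<^sub>R x"
      "(3 / 2) *\<^sub>R (x * x) = x * x + (1 / 4) *\<^sub>R (x * x) + (1 / 4) *\<^sub>R (x * x)"
      using scaleR_left_distrib[of 1 "1/2" "x * x"]
      by (simp_all add: add.assoc flip: scaleR_left_distrib)
    then show ?thesis by (simp add: newton_step_def algebra_simps scaleR_2)
  qed
  have x4: "norm (1 - (1 / 4) *\<^sub>R x) \<le> 1"
    using norm_complement_pos[OF pos_scaleR[OF x(1), of "1/4"], of 1] x(2) by simp
  have e: "norm (e ^ n) \<le> 1" for n
  proof (induction n)
    case 0
    then show ?case by (simp add: norm_1_le)
  next
    case (Suc n)
    then show ?case
      using norm_complement_pos[OF d] by (simp add: norm_mult_le_1 e_def)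
  qed
  obtain s where s: "pos s" "s * s = x" using pos_sqrt[OF x(1)] by blast
  define u where "u = (3 / 2) *\<^sub>R 1 - (1 / 2) *\<^sub>R x"
  have "u * s = s * u"
    by (simp add: u_def algebra_simps flip: s(2))
  have "(3 / 2) *\<^sub>R (x * x) = (3 / 4) *\<^sub>R (x * x) + (3 / 4) *\<^sub>R (x * x)"
    by (simp flip: scaleR_left_distrib)
  then have "newton_step x = x * (u * u)"
    by (simp add: newton_step_def u_def algebra_simps)
  also have "\<dots> = (s * u) * (s * u)"
    by (simp add: mult.assoc mult_swap[OF \<open>u * s = s * u\<close>] flip: s(2))
  finally have "newton_step x = (s * u) * (s * u)" .
  moreover have "adj (s * u) = s * u"
    using \<open>u * s = s * u\<close> by (simp add: adj_mult u_def adj_diff adj_scaleR adj_x pos_selfadjoint s(1))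
  ultimately have pos: "pos (newton_step x)" using pos_square by simp
  have "pos (1 - (1 / 4) *\<^sub>R x)"
    using pos_complement[of "(1 / 4) *\<^sub>R x" 1] x(2) adj_x by (simp add: adj_scaleR)
  \<comment> \<open>A root of 1 - x/4 makes the complement of the Newton step the square of (1 - x)
    r, so the next iterate also lies between 0 and 1.\<close>
  obtain r where r: "pos r" "r * r = 1 - (1 / 4) *\<^sub>R x"
    "\<And>z. z * (1 - (1 / 4) *\<^sub>R x) = (1 - (1 / 4) *\<^sub>R x) * z \<Longrightarrow> z * r = r * z"
    using pos_sqrt[OF \<open>pos (1 - (1 / 4) *\<^sub>R x)\<close>] by blast
  have rx: "(1 - x) * r = r * (1 - x)"
    by (rule r(3)) (simp add: algebra_simps)
  have "1 - newton_step x = ((1 - x) * r) * ((1 - x) * r)"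
    by (simp add: complement r(2)[symmetric] mult.assoc mult_swap[OF rx[symmetric]])
  moreover have "adj ((1 - x) * r) = (1 - x) * r"
    by (simp add: adj_mult pos_selfadjoint r(1) adj_diff adj_x rx)
  ultimately have "pos (1 - newton_step x)" using pos_square by simp
  then have norm: "norm (newton_step x) \<le> 1"
    using norm_le_of_complement_pos[OF pos, of 1] by simp
  have comm: "newton_step x * d = d * newton_step x"
  proof -
    have "x * (x * d) = d * (x * x)" "x * (x * (x * d)) = d * (x * (x * x))"
      by (simp_all add: x(3) mult_swap[OF x(3)])
    then show ?thesis using x(3) by (simp add: newton_step_def algebra_simps)
  qed
  \<comment> \<open>The squared factor supplies the exponent 2n + 2; n + 2 of it is kept and e^n
    goes into the new contraction.\<close>
  define l where "l = e ^ n * k * k * (1 - (1 / 4) *\<^sub>R x)"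
  have l1: "norm l \<le> 1"
    unfolding l_def by (intro norm_mult_le_1 e k(1) x4)
  have ed: "e * d = d * e" by (simp add: e_def algebra_simps)
  have en_d: "e ^ n * d = d * e ^ n"
    using power_commuting_commutes[OF ed] .
  have xd: "(1 - (1 / 4) *\<^sub>R x) * d = d * (1 - (1 / 4) *\<^sub>R x)"
    by (simp add: algebra_simps x(3))
  have l2: "l * d = d * l"
    unfolding l_def
    by (simp only: mult.assoc xd k(2) en_d mult_swap[OF k(2)] mult_swap[OF en_d])
  have "k * e = e * k" by (simp add: e_def algebra_simps k(2))
  then have ke: "e ^ m * k = k * e ^ m" for m
    using power_commuting_commutes[of e k] by simp
  have "1 - newton_step x = e ^ Suc n * k * (e ^ Suc n * k) * (1 - (1 / 4) *\<^sub>R x)"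
    unfolding complement k(3) ..
  also have "\<dots> = e ^ Suc n * e ^ Suc n * k * k * (1 - (1 / 4) *\<^sub>R x)"
    by (simp only: mult.assoc mult_swap[OF ke[symmetric]])
  also have "e ^ Suc n * e ^ Suc n = e ^ Suc (Suc n) * e ^ n"
    by (simp only: power_add[symmetric]) simp
  finally have "1 - newton_step x = e ^ Suc (Suc n) * l"
    by (simp only: l_def mult.assoc)
  then show ?case
    unfolding DS using pos norm comm l1 l2 unfolding e_def by blast
qed

text \<open>For f = 1 - D the squared norm of f x is the norm of f x x* f, which is at most that of
  f d f because x x* is below d. Since f contains the factor (1 - d)^(n + 1), this is at most 1/(n +
  1).\<close>

lemma newton_tendsto:
  fixes d x :: "'a::unital_cstar_algebra"
  assumes d: "pos d" "norm d \<le> 1" and dx: "pos (d - x * adj x)"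
  shows "(\<lambda>n. (newton_step ^^ n) d * x) \<longlonglongrightarrow> x"
proof -
  let ?D = "\<lambda>n. (newton_step ^^ n) d"
  have "(norm (x - ?D n * x))\<^sup>2 \<le> 1 / real (Suc n)" for n
  proof -
    define f where "f = 1 - ?D n"
    note N = newton_iteration[OF d, of n]
    obtain k where k: "norm k \<le> 1" "k * d = d * k" "f = (1 - d) ^ Suc n * k"
      using N by (auto simp: f_def)
    have f: "adj f = f" using N by (simp add: f_def adj_diff pos_selfadjoint)
    have fd: "f * d = d * f" using N by (simp add: f_def algebra_simps)
    have f1: "norm f \<le> 1"
      using norm_complement_pos[of "?D n" 1] N by (simp add: f_def)
    have "(norm (f * x))\<^sup>2 = norm (f * (x * adj x) * adj f)"
      using norm_mult_adj[of "f * x"] unfolding norm_adj by (simp add: adj_mult mult.assoc)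
    also have "\<dots> \<le> norm (f * (x * adj x) * adj f + f * (d - x * adj x) * adj f)"
      by (intro pos_norm_mono pos_conj pos_mult_adj dx)
    also have "f * (x * adj x) * adj f + f * (d - x * adj x) * adj f = d * f * f"
      by (simp add: algebra_simps f fd)
    also have "\<dots> = (d * (1 - d) ^ Suc n) * k * f"
      using k(3) by (simp add: mult.assoc)
    also have "norm \<dots> \<le> norm (d * (1 - d) ^ Suc n) * norm k * norm f"
      by (meson norm_mult_ineq mult_right_mono norm_ge_zero order_trans)
    also have "\<dots> \<le> norm (d * (1 - d) ^ Suc n) * 1 * 1"
      using k(1) f1 by (intro mult_mono) auto
    also have "\<dots> \<le> 1 / real (Suc n)"
      using norm_mult_complement_power[OF d, of "Suc n"] by (simp add: field_simps)
    finally show ?thesis by (simp add: f_def left_diff_distrib)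
  qed
  then have "norm (x - ?D n * x) \<le> sqrt (1 / real (Suc n))" for n
    by (simp add: real_le_rsqrt)
  moreover have "(\<lambda>n. sqrt (1 / real (Suc n))) \<longlonglongrightarrow> 0"
    using tendsto_real_sqrt[OF LIMSEQ_inverse_real_of_nat] by (simp add: inverse_eq_divide)
  ultimately have "(\<lambda>n. x - ?D n * x) \<longlonglongrightarrow> 0"
    by (rule Lim_null_comparison[OF always_eventually[OF allI]])
  from tendsto_diff[OF tendsto_const this, of x] show ?thesis by simp
qed

section \<open>Adjointable operators on a C*-algebra\<close>

text \<open>Left multiplication embeds a C*-algebra isometrically into the unital C*-algebra of adjointable
  operators on it; this serves as a unitization that needs no case distinction on unitality.\<close>

lemma adj_mult_cancel:
  fixes z w :: "'a::cstar_algebra"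
  assumes "\<And>x. adj x * z = adj x * w"
  shows "z = w"
proof -
  have "adj (z - w) * (z - w) = 0"
    using assms[of "z - w"] by (simp add: right_diff_distrib)
  from adj_mult_self_eq_0D[OF this] show ?thesis by simp
qed

text \<open>Adjointness for the algebra-valued inner product \<open>adj x * y\<close>.\<close>

definition is_adjoint :: "('a::cstar_algebra \<Rightarrow>\<^sub>L 'a) \<Rightarrow> ('a \<Rightarrow>\<^sub>L 'a) \<Rightarrow> bool" where
  "is_adjoint f g \<longleftrightarrow> (\<forall>x y. adj (blinfun_apply f x) * y = adj x * blinfun_apply g y)"

lemma is_adjointD: "is_adjoint f g \<Longrightarrow> adj (blinfun_apply f x) * y = adj x * blinfun_apply g y"
  by (simp add: is_adjoint_def)

lemma is_adjoint_sym: "is_adjoint f g \<Longrightarrow> is_adjoint g f"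
  unfolding is_adjoint_def by (metis adj_adj adj_mult)

lemma is_adjoint_unique: "is_adjoint f g \<Longrightarrow> is_adjoint f h \<Longrightarrow> g = h"
  by (rule blinfun_eqI, rule adj_mult_cancel) (simp add: is_adjointD[symmetric])

text \<open>The nontrivial half of the C*-identity for operators: the square of |f x| is the norm of
  \<open>adj x * g (f x)\<close>.\<close>

lemma is_adjoint_norm:
  assumes "is_adjoint f g"
  shows "(norm f)\<^sup>2 \<le> norm (g o\<^sub>L f)"
proof -
  have "norm (blinfun_apply f x) \<le> sqrt (norm (g o\<^sub>L f)) * norm x" for x
  proof -
    have "(norm (blinfun_apply f x))\<^sup>2 = norm (adj x * blinfun_apply (g o\<^sub>L f) x)"
      by (simp add: cstar_identity[symmetric] is_adjointD[OF assms])
    also have "\<dots> \<le> norm x * (norm (g o\<^sub>L f) * norm x)"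
      using norm_mult_ineq[of "adj x"] norm_blinfun[of "g o\<^sub>L f" x]
      by (smt (verit) mult_left_mono norm_adj norm_ge_zero)
    also have "\<dots> = (sqrt (norm (g o\<^sub>L f)) * norm x)\<^sup>2"
      by (simp add: power2_eq_square)
    finally show ?thesis by (rule power2_le_imp_le) simp
  qed
  then have "norm f \<le> sqrt (norm (g o\<^sub>L f))"
    by (intro norm_blinfun_bound) simp_all
  then have "(norm f)\<^sup>2 \<le> (sqrt (norm (g o\<^sub>L f)))\<^sup>2"
    by (rule power_mono) simp
  then show ?thesis by simp
qed

lemma is_adjoint_norm_le: "is_adjoint f g \<Longrightarrow> norm f \<le> norm g"
proof (cases "f = 0")
  case False
  assume "is_adjoint f g"
  then have "norm f * norm f \<le> norm g * norm f"
    using is_adjoint_norm[of f g] norm_blinfun_compose[of g f] by (simp add: power2_eq_square)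
  then show ?thesis using False by simp
qed simp

lemma is_adjoint_norm_eq: "is_adjoint f g \<Longrightarrow> norm f = norm g"
  using is_adjoint_norm_le[of f g] is_adjoint_norm_le[of g f] is_adjoint_sym[of f g] by simp

lemma is_adjoint_zero: "is_adjoint 0 0"
  and is_adjoint_add: "is_adjoint f g \<Longrightarrow> is_adjoint f' g' \<Longrightarrow> is_adjoint (f + f') (g + g')"
  and is_adjoint_minus: "is_adjoint f g \<Longrightarrow> is_adjoint (- f) (- g)"
  and is_adjoint_diff: "is_adjoint f g \<Longrightarrow> is_adjoint f' g' \<Longrightarrow> is_adjoint (f - f') (g - g')"
  and is_adjoint_scaleR: "is_adjoint f g \<Longrightarrow> is_adjoint (r *\<^sub>R f) (r *\<^sub>R g)"
  and is_adjoint_id: "is_adjoint id_blinfun id_blinfun"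
  and is_adjoint_compose: "is_adjoint f g \<Longrightarrow> is_adjoint f' g' \<Longrightarrow> is_adjoint (f o\<^sub>L f') (g' o\<^sub>L g)"
  by (simp_all add: is_adjoint_def blinfun.bilinear_simps adj_add adj_minus adj_diff adj_scaleR algebra_simps)

lift_definition blinfun_scaleC :: "complex \<Rightarrow> ('a::cstar_algebra \<Rightarrow>\<^sub>L 'a) \<Rightarrow> ('a \<Rightarrow>\<^sub>L 'a)" is
  "\<lambda>c f x. c *\<^sub>C f x"
  by (rule bounded_linear_compose[OF bounded_linear_scaleC])

declare blinfun_scaleC.rep_eq [simp]

lemma is_adjoint_scaleC:
  "is_adjoint f g \<Longrightarrow> is_adjoint (blinfun_scaleC c f) (blinfun_scaleC (cnj c) g)"
  by (simp add: is_adjoint_def adj_scaleC mult_scaleC_left mult_scaleC_right)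

text \<open>Bounded operators here are only real linear; having an adjoint forces complex
  linearity.\<close>

lemma adjointable_scaleC:
  assumes "is_adjoint f g"
  shows "blinfun_apply f (c *\<^sub>C x) = c *\<^sub>C blinfun_apply f x"
proof (rule adj_mult_cancel)
  fix y
  show "adj y * blinfun_apply f (c *\<^sub>C x) = adj y * c *\<^sub>C blinfun_apply f x"
    by (simp add: is_adjointD[OF is_adjoint_sym[OF assms], symmetric] mult_scaleC_right)
qed

lemma norm_blinfun_scaleC: "norm (blinfun_scaleC c f) = cmod c * norm f"
proof -
  have le: "norm (blinfun_scaleC c f) \<le> cmod c * norm f" for c and f :: "'a \<Rightarrow>\<^sub>L 'a"
    using norm_blinfun[of f]
    by (intro norm_blinfun_bound) (auto simp: norm_scaleC mult.assoc intro: mult_left_mono)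
  show ?thesis
  proof (cases "c = 0")
    case False
    have "blinfun_scaleC (inverse c) (blinfun_scaleC c f) = f"
      by (rule blinfun_eqI) (simp add: False scaleC_scaleC scaleC_one)
    then have "norm f \<le> cmod (inverse c) * norm (blinfun_scaleC c f)"
      using le[of "inverse c" "blinfun_scaleC c f"] by simp
    then have "cmod c * norm f \<le> norm (blinfun_scaleC c f)"
      using False by (simp only: norm_inverse) (simp add: field_simps)
    then show ?thesis using le[of c f] by simp
  qed (use le[of 0 f] in simp)
qed

typedef (overloaded) 'a adjointable = "{f :: 'a::cstar_algebra \<Rightarrow>\<^sub>L 'a. \<exists>g. is_adjoint f g}"
  using is_adjoint_zero by blast

setup_lifting type_definition_adjointable

definition blinfun_adj :: "('a::cstar_algebra \<Rightarrow>\<^sub>L 'a) \<Rightarrow> ('a \<Rightarrow>\<^sub>L 'a)" where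
  "blinfun_adj f = (THE g. is_adjoint f g)"

lemma blinfun_adj_eq: "is_adjoint f g \<Longrightarrow> blinfun_adj f = g"
  unfolding blinfun_adj_def by (blast intro: is_adjoint_unique)

section \<open>The unital C*-algebra of adjointable operators\<close>

instantiation adjointable :: (cstar_algebra) real_normed_algebra
begin

lift_definition zero_adjointable :: "'a adjointable" is 0
  using is_adjoint_zero by blast
lift_definition plus_adjointable :: "'a adjointable \<Rightarrow> 'a adjointable \<Rightarrow> 'a adjointable" is "(+)"
  using is_adjoint_add by blast
lift_definition minus_adjointable :: "'a adjointable \<Rightarrow> 'a adjointable \<Rightarrow> 'a adjointable" is "(-)"
  using is_adjoint_diff by blast
lift_definition uminus_adjointable :: "'a adjointable \<Rightarrow> 'a adjointable" is uminus
  using is_adjoint_minus by blast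
lift_definition scaleR_adjointable :: "real \<Rightarrow> 'a adjointable \<Rightarrow> 'a adjointable" is scaleR
  using is_adjoint_scaleR by blast
lift_definition times_adjointable :: "'a adjointable \<Rightarrow> 'a adjointable \<Rightarrow> 'a adjointable" is "(o\<^sub>L)"
  using is_adjoint_compose by blast
lift_definition norm_adjointable :: "'a adjointable \<Rightarrow> real" is norm .

definition dist_adjointable :: "'a adjointable \<Rightarrow> 'a adjointable \<Rightarrow> real" where
  "dist_adjointable a b = norm (a - b)"
definition uniformity_adjointable :: "('a adjointable \<times> 'a adjointable) filter" where
  "uniformity_adjointable = (INF e\<in>{0<..}. principal {(x, y). dist x y < e})"
definition open_adjointable :: "'a adjointable set \<Rightarrow> bool" where
  "open_adjointable U \<longleftrightarrow> (\<forall>x\<in>U. \<forall>\<^sub>F (x', y) in uniformity. x' = x \<longrightarrow> y \<in> U)"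
definition sgn_adjointable :: "'a adjointable \<Rightarrow> 'a adjointable" where
  "sgn_adjointable x = inverse (norm x) *\<^sub>R x"

instance
proof
  fix a b c :: "'a adjointable" and r s :: real
  show "a + b + c = a + (b + c)" by transfer simp
  show "a + b = b + a" by transfer simp
  show "0 + a = a" by transfer simp
  show "- a + a = 0" by transfer simp
  show "a - b = a + - b" by transfer simp
  show "r *\<^sub>R (a + b) = r *\<^sub>R a + r *\<^sub>R b" by transfer (simp add: scaleR_add_right)
  show "(r + s) *\<^sub>R a = r *\<^sub>R a + s *\<^sub>R a" by transfer (simp add: scaleR_add_left)
  show "r *\<^sub>R s *\<^sub>R a = (r * s) *\<^sub>R a" by transfer simp
  show "1 *\<^sub>R a = a" by transfer simp
  show "a * b * c = a * (b * c)" by transfer (rule blinfun_eqI, simp)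
  show "(a + b) * c = a * c + b * c" by transfer (rule blinfun_eqI, simp add: blinfun.bilinear_simps)
  show "a * (b + c) = a * b + a * c" by transfer (rule blinfun_eqI, simp add: blinfun.bilinear_simps)
  show "r *\<^sub>R a * b = r *\<^sub>R (a * b)" by transfer (rule blinfun_eqI, simp add: blinfun.bilinear_simps)
  show "a * r *\<^sub>R b = r *\<^sub>R (a * b)" by transfer (rule blinfun_eqI, simp add: blinfun.bilinear_simps)
  show "dist a b = norm (a - b)" by (rule dist_adjointable_def)
  show "(norm a = 0) = (a = 0)" by transfer simp
  show "norm (a + b) \<le> norm a + norm b" by transfer (rule norm_triangle_ineq)
  show "norm (r *\<^sub>R a) = \<bar>r\<bar> * norm a" by transfer simp
  show "norm (a * b) \<le> norm a * norm b" by transfer (rule norm_blinfun_compose)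
  show "sgn a = inverse (norm a) *\<^sub>R a" by (rule sgn_adjointable_def)
  show "(uniformity :: ('a adjointable \<times> 'a adjointable) filter) =
      (INF e\<in>{0<..}. principal {(x, y). dist x y < e})"
    by (rule uniformity_adjointable_def)
  show "open U = (\<forall>x\<in>U. \<forall>\<^sub>F (x', y) in uniformity. x' = x \<longrightarrow> y \<in> U)" for U :: "'a adjointable set"
    by (rule open_adjointable_def)
qed

end

instantiation adjointable :: (cstar_algebra) unital_cstar_algebra
begin

lift_definition one_adjointable :: "'a adjointable" is id_blinfun
  using is_adjoint_id by blast
lift_definition scaleC_adjointable :: "complex \<Rightarrow> 'a adjointable \<Rightarrow> 'a adjointable" is blinfun_scaleC
  using is_adjoint_scaleC by blast
lift_definition adj_adjointable :: "'a adjointable \<Rightarrow> 'a adjointable" is blinfun_adj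
  using blinfun_adj_eq is_adjoint_sym by fastforce

instance
proof
  fix a b :: "'a adjointable" and c d :: complex and r :: real
  show "r *\<^sub>R a = complex_of_real r *\<^sub>C a"
    by transfer (rule blinfun_eqI, simp add: blinfun.bilinear_simps scaleR_scaleC)
  show "c *\<^sub>C (a + b) = c *\<^sub>C a + c *\<^sub>C b"
    by transfer (rule blinfun_eqI, simp add: blinfun.bilinear_simps scaleC_add_right)
  show "(c + d) *\<^sub>C a = c *\<^sub>C a + d *\<^sub>C a"
    by transfer (rule blinfun_eqI, simp add: blinfun.bilinear_simps scaleC_add_left)
  show "c *\<^sub>C d *\<^sub>C a = (c * d) *\<^sub>C a"
    by transfer (rule blinfun_eqI, simp add: scaleC_scaleC)
  show "c *\<^sub>C a * b = c *\<^sub>C (a * b)"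
    by transfer (rule blinfun_eqI, simp)
  show "a * c *\<^sub>C b = c *\<^sub>C (a * b)"
    by transfer (rule blinfun_eqI, auto simp: adjointable_scaleC)
  show "norm (c *\<^sub>C a) = cmod c * norm a"
    by transfer (rule norm_blinfun_scaleC)
  show "adj (a + b) = adj a + adj b"
    by transfer (clarsimp simp: blinfun_adj_eq, rule blinfun_adj_eq, erule (1) is_adjoint_add)
  show "adj (c *\<^sub>C a) = cnj c *\<^sub>C adj a"
    by transfer (clarsimp simp: blinfun_adj_eq, rule blinfun_adj_eq, erule is_adjoint_scaleC)
  show "adj (a * b) = adj b * adj a"
    by transfer (clarsimp simp: blinfun_adj_eq, rule blinfun_adj_eq, erule (1) is_adjoint_compose)
  show "adj (adj a) = a"
    by transfer (clarsimp simp: blinfun_adj_eq, rule blinfun_adj_eq, erule is_adjoint_sym)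
  show "norm (adj a * a) = (norm a)\<^sup>2"
  proof transfer
    fix f :: "'a \<Rightarrow>\<^sub>L 'a"
    assume "\<exists>g. is_adjoint f g"
    then obtain g where g: "is_adjoint f g" by blast
    have "norm (g o\<^sub>L f) \<le> (norm f)\<^sup>2"
      using norm_blinfun_compose[of g f] is_adjoint_norm_eq[OF g] by (simp add: power2_eq_square)
    then show "norm (blinfun_adj f o\<^sub>L f) = (norm f)\<^sup>2"
      using is_adjoint_norm[OF g] by (simp add: blinfun_adj_eq[OF g])
  qed
  show "1 * a = a" by transfer (rule blinfun_eqI, simp)
  show "a * 1 = a" by transfer (rule blinfun_eqI, simp)
next
  fix X :: "nat \<Rightarrow> 'a adjointable"
  assume X: "Cauchy X"
  define f g where "f n = Rep_adjointable (X n)" and "g n = blinfun_adj (f n)" for n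
  have adjoint: "is_adjoint (f n) (g n)" for n
    using Rep_adjointable[of "X n"] by (auto simp: f_def g_def blinfun_adj_eq)
  have "Cauchy f"
    using X unfolding Cauchy_def dist_norm f_def
    by (simp add: norm_adjointable.rep_eq minus_adjointable.rep_eq)
  then obtain f' where f': "f \<longlonglongrightarrow> f'" using Cauchy_convergent convergent_def by blast
  \<comment> \<open>Taking adjoints is isometric, so the adjoints converge as well, and the adjoint
    relation passes to the limits.\<close>
  have "norm (g m - g n) = norm (f m - f n)" for m n
    using is_adjoint_norm_eq[OF is_adjoint_diff[OF adjoint adjoint]] by simp
  then have "Cauchy g" using \<open>Cauchy f\<close> by (simp add: Cauchy_def dist_norm)
  then obtain g' where g': "g \<longlonglongrightarrow> g'" using Cauchy_convergent convergent_def by blast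
  have "is_adjoint f' g'"
    unfolding is_adjoint_def
  proof (intro allI)
    fix x y
    have "(\<lambda>n. adj (blinfun_apply (f n) x) * y) \<longlonglongrightarrow> adj (blinfun_apply f' x) * y"
      by (intro tendsto_intros f')
    moreover have "(\<lambda>n. adj x * blinfun_apply (g n) y) \<longlonglongrightarrow> adj x * blinfun_apply g' y"
      by (intro tendsto_intros g')
    ultimately show "adj (blinfun_apply f' x) * y = adj x * blinfun_apply g' y"
      using LIMSEQ_unique by (simp add: is_adjointD[OF adjoint])
  qed
  then have Rep: "Rep_adjointable (Abs_adjointable f') = f'"
    by (intro Abs_adjointable_inverse) blast
  have "X \<longlonglongrightarrow> Abs_adjointable f'"
    using f' unfolding LIMSEQ_iff
    by (simp add: norm_adjointable.rep_eq minus_adjointable.rep_eq Rep f_def)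
  then show "convergent X" by (auto simp: convergent_def)
qed

end

section \<open>The isometric embedding by left multiplication\<close>

lift_definition left_mult :: "'a::cstar_algebra \<Rightarrow> 'a adjointable" is blinfun_mult_right
proof -
  fix a :: 'a
  have "is_adjoint (blinfun_mult_right a) (blinfun_mult_right (adj a))"
    by (simp add: is_adjoint_def adj_mult mult.assoc)
  then show "\<exists>g. is_adjoint (blinfun_mult_right a) g" by blast
qed

lemma left_mult_add: "left_mult (a + b) = left_mult a + left_mult b"
  by transfer (rule blinfun_eqI, simp add: blinfun.bilinear_simps distrib_right)

lemma left_mult_diff: "left_mult (a - b) = left_mult a - left_mult b"
  by transfer (rule blinfun_eqI, simp add: blinfun.bilinear_simps left_diff_distrib)

lemma left_mult_scaleR: "left_mult (r *\<^sub>R a) = r *\<^sub>R left_mult a"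
  by transfer (rule blinfun_eqI, simp add: blinfun.bilinear_simps)

lemma left_mult_mult: "left_mult (a * b) = left_mult a * left_mult b"
  by transfer (rule blinfun_eqI, simp add: mult.assoc)

lemma left_mult_adj: "left_mult (adj a) = adj (left_mult a)"
  by transfer (rule blinfun_adj_eq[symmetric], simp add: is_adjoint_def adj_mult mult.assoc)

lemma norm_left_mult: "norm (left_mult a) = norm (a :: 'a::cstar_algebra)"
proof (rule antisym)
  show "norm (left_mult a) \<le> norm a"
    by transfer (rule norm_blinfun_bound, simp_all add: norm_mult_ineq)
  \<comment> \<open>Evaluation at \<open>adj a\<close> attains the norm, by the C*-identity.\<close>
  have "norm a * norm a = norm (a * adj a)"
    by (simp add: norm_mult_adj power2_eq_square)
  also have "\<dots> \<le> norm (left_mult a) * norm a"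
    using norm_blinfun[of "blinfun_mult_right a" "adj a"] by transfer simp
  finally show "norm a \<le> norm (left_mult a)"
    by (cases "a = 0") simp_all
qed

section \<open>Positivity without a unit, and multipliers\<close>

text \<open>\<open>positive\<close> asks for a factorization, which a sum does not visibly have; in
  the unital algebra of operators positivity is a cone.\<close>

definition psd :: "'a::cstar_algebra \<Rightarrow> bool" where
  "psd a \<longleftrightarrow> pos (left_mult a)"

lemma psd_adj_mult: "psd (adj c * c)"
  by (simp add: psd_def left_mult_mult left_mult_adj pos_adj_mult)

lemma psd_mult_adj: "psd (c * adj c)"
  using psd_adj_mult[of "adj c"] by (simp add: adj_adj)

lemma psd_positive: "positive a \<Longrightarrow> psd a"
  by (auto simp: positive_def psd_adj_mult)

lemma psd_0: "psd 0"
  using psd_adj_mult[of 0] by simp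

lemma psd_add: "psd a \<Longrightarrow> psd b \<Longrightarrow> psd (a + b)"
  by (simp add: psd_def left_mult_add pos_add)

lemma psd_sum: "(\<And>i. i \<in> I \<Longrightarrow> psd (f i)) \<Longrightarrow> psd (\<Sum>i\<in>I. f i)"
  by (induction I rule: infinite_finite_induct) (simp_all add: psd_0 psd_add)

lemma psd_conj: "psd a \<Longrightarrow> psd (adj g * a * g)"
  using pos_conj[of "left_mult a" "left_mult (adj g)"]
  by (simp add: psd_def left_mult_mult left_mult_adj adj_adj)

lemma psd_norm_mono: "psd a \<Longrightarrow> psd b \<Longrightarrow> norm a \<le> norm (a + b)"
  using pos_norm_mono[of "left_mult a" "left_mult b"]
  by (simp add: psd_def norm_left_mult flip: left_mult_add)

text \<open>\<open>newton_step\<close> has no constant term, so it makes sense without a unit and is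
  preserved by the embedding.\<close>

lemma left_mult_newton: "left_mult ((newton_step ^^ n) d) = (newton_step ^^ n) (left_mult d)"
  by (induction n)
    (simp_all add: newton_step_def left_mult_add left_mult_diff left_mult_scaleR left_mult_mult)

lemma newton_norm_le: "psd d \<Longrightarrow> norm d \<le> 1 \<Longrightarrow> norm ((newton_step ^^ n) d) \<le> 1"
  using newton_iteration[of "left_mult d" n]
  by (simp add: psd_def norm_left_mult flip: left_mult_newton)

lemma newton_mult_tendsto:
  assumes "psd d" "norm d \<le> 1" "psd (d - x * adj x)"
  shows "(\<lambda>n. (newton_step ^^ n) d * x) \<longlonglongrightarrow> x"
proof -
  have "(\<lambda>n. (newton_step ^^ n) (left_mult d) * left_mult x) \<longlonglongrightarrow> left_mult x"
    using assms
    by (intro newton_tendsto) (simp_all add: psd_def norm_left_mult left_mult_diff left_mult_mult left_mult_adj)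
  then show ?thesis
    unfolding LIMSEQ_iff left_mult_newton[symmetric] left_mult_mult[symmetric]
      left_mult_diff[symmetric] norm_left_mult .
qed

text \<open>The constant \<open>k\<close> is i or -i according to which argument of \<open>s\<close>
  is conjugate-linear. The conclusion is membership in a subspace, so \<open>B\<close> yields
  closure statements and the zero subspace yields identities.\<close>

lemma polarization:
  fixes s :: "'a::cstar_algebra \<Rightarrow> 'a \<Rightarrow> 'b::cstar_algebra"
  assumes V: "csubspace V"
    and diag: "s a a \<in> V" "s b b \<in> V" "s (a + b) (a + b) \<in> V" "s (a + \<i> *\<^sub>C b) (a + \<i> *\<^sub>C b) \<in> V"
    and add: "s (a + b) (a + b) = s a a + s a b + s b a + s b b"
    and i: "s (a + \<i> *\<^sub>C b) (a + \<i> *\<^sub>C b) = s a a + k *\<^sub>C s a b - k *\<^sub>C s b a + s b b"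
    and k: "k * k = - 1"
  shows "s a b \<in> V"
proof -
  note subspace = complex_vector.subspace_add[OF V] complex_vector.subspace_diff[OF V]
    complex_vector.subspace_scale[OF V]
  have "(1 / 2) *\<^sub>C ((s (a + b) (a + b) - s a a - s b b) +
      (- k) *\<^sub>C (s (a + \<i> *\<^sub>C b) (a + \<i> *\<^sub>C b) - s a a - s b b)) \<in> V"
    by (intro subspace diag)
  also have "(s (a + b) (a + b) - s a a - s b b) +
      (- k) *\<^sub>C (s (a + \<i> *\<^sub>C b) (a + \<i> *\<^sub>C b) - s a a - s b b) = s a b + s a b"
    unfolding add i
    by (simp add: complex_vector.scale_right_diff_distrib complex_vector.scale_right_distrib
        scaleC_scaleC k scaleC_minus1 algebra_simps scaleC_one)
  also have "(1 / 2) *\<^sub>C (s a b + s a b) = s a b"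
    by (simp add: scaleC_add_right scaleC_one flip: scaleC_add_left)
  finally show ?thesis .
qed

lemma csubspace_closure:
  assumes "csubspace S"
  shows "csubspace (closure S)"
proof (rule complex_vector.subspaceI)
  show "0 \<in> closure S"
    using complex_vector.subspace_0[OF assms] closure_subset by blast
  fix x y c
  assume "x \<in> closure S" "y \<in> closure S"
  then obtain f g where f: "\<And>n. f n \<in> S" "f \<longlonglongrightarrow> x" and g: "\<And>n. g n \<in> S" "g \<longlonglongrightarrow> y"
    unfolding closure_sequential by blast
  show "x + y \<in> closure S"
    unfolding closure_sequential
    by (intro exI[of _ "\<lambda>n. f n + g n"] conjI allI complex_vector.subspace_add[OF assms]
        tendsto_add f g)
  show "c *\<^sub>C x \<in> closure S"
    unfolding closure_sequential
    by (intro exI[of _ "\<lambda>n. c *\<^sub>C f n"] conjI allI complex_vector.subspace_scale[OF assms]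
        bounded_linear.tendsto[OF bounded_linear_scaleC] f)
qed

section \<open>Strict convergence and the construction of multipliers\<close>

lemma limitin_topology_generated_by:
  "limitin (topology_generated_by \<S>) f l F \<longleftrightarrow> l \<in> \<Union>\<S> \<and> (\<forall>U\<in>\<S>. l \<in> U \<longrightarrow> (\<forall>\<^sub>F x in F. f x \<in> U))"
proof (intro iffI conjI ballI impI)
  assume "limitin (topology_generated_by \<S>) f l F"
  then show "l \<in> \<Union>\<S>" by (simp add: limitin_def)
  show "\<forall>\<^sub>F x in F. f x \<in> U" if "U \<in> \<S>" "l \<in> U" for U
    using \<open>limitin (topology_generated_by \<S>) f l F\<close> that topology_generated_by_Basis
    by (auto simp: limitin_def)
next
  assume l: "l \<in> \<Union>\<S> \<and> (\<forall>U\<in>\<S>. l \<in> U \<longrightarrow> (\<forall>\<^sub>F x in F. f x \<in> U))"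
  have "l \<in> U \<Longrightarrow> \<forall>\<^sub>F x in F. f x \<in> U" if "generate_topology_on \<S> U" for U
    using that
  proof induction
    case (UN K)
    then obtain k where "k \<in> K" "l \<in> k" by blast
    then have "\<forall>\<^sub>F x in F. f x \<in> k" using UN.IH by blast
    then show ?case by eventually_elim (use \<open>k \<in> K\<close> in blast)
  qed (use l in \<open>auto intro: eventually_conj\<close>)
  then show "limitin (topology_generated_by \<S>) f l F"
    using l by (auto simp: limitin_def openin_topology_generated_by_iff)
qed

text \<open>Subbasic sets are centred at arbitrary \<open>S\<close>, so the distance to
  \<open>S\<close> is followed along the net and the strict inequality at the limit is used.\<close>

lemma limitin_strict_topology:
  assumes "\<tau> \<in> multiplier_algebra J" "\<And>x. f x \<in> multiplier_algebra J"
    and "\<And>a. a \<in> J \<Longrightarrow> ((\<lambda>x. lmult (f x) a) \<longlongrightarrow> lmult \<tau> a) F"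
    and "\<And>a. a \<in> J \<Longrightarrow> ((\<lambda>x. rmult (f x) a) \<longlongrightarrow> rmult \<tau> a) F"
    and "0 \<in> J"
  shows "limitin (strict_topology J) f \<tau> F"
  unfolding strict_topology_def limitin_topology_generated_by
proof (intro conjI ballI impI)
  show "\<tau> \<in> \<Union> {{T \<in> multiplier_algebra J.
      norm (lmult T a - lmult S a) < e \<and> norm (rmult T a - rmult S a) < e} | S a e.
      S \<in> multiplier_algebra J \<and> a \<in> J \<and> e > 0}"
  \<comment> \<open>Membership in the underlying space needs one subbasic set; the element
    \<open>0\<close> of \<open>J\<close> provides it.\<close>
  proof (rule UnionI)
    show "{T \<in> multiplier_algebra J. norm (lmult T 0 - lmult \<tau> 0) < 1 \<and> norm (rmult T 0 - rmult \<tau> 0) < 1}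
      \<in> {{T \<in> multiplier_algebra J.
        norm (lmult T a - lmult S a) < e \<and> norm (rmult T a - rmult S a) < e} | S a e.
        S \<in> multiplier_algebra J \<and> a \<in> J \<and> e > 0}"
      using assms(1,5) zero_less_one by blast
  qed (use assms(1) in simp)
  fix U
  assume "U \<in> {{T \<in> multiplier_algebra J.
      norm (lmult T a - lmult S a) < e \<and> norm (rmult T a - rmult S a) < e} | S a e.
      S \<in> multiplier_algebra J \<and> a \<in> J \<and> e > 0}" and "\<tau> \<in> U"
  then obtain S a e where U: "U = {T \<in> multiplier_algebra J.
      norm (lmult T a - lmult S a) < e \<and> norm (rmult T a - rmult S a) < e}" and "a \<in> J"
    by blast
  have "((\<lambda>x. norm (lmult (f x) a - lmult S a)) \<longlongrightarrow> norm (lmult \<tau> a - lmult S a)) F"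
    "((\<lambda>x. norm (rmult (f x) a - rmult S a)) \<longlongrightarrow> norm (rmult \<tau> a - rmult S a)) F"
    by (intro tendsto_intros assms \<open>a \<in> J\<close>)+
  moreover have "norm (lmult \<tau> a - lmult S a) < e" "norm (rmult \<tau> a - rmult S a) < e"
    using \<open>\<tau> \<in> U\<close> U by auto
  ultimately have "\<forall>\<^sub>F x in F. norm (lmult (f x) a - lmult S a) < e \<and> norm (rmult (f x) a - rmult S a) < e"
    by (intro eventually_conj order_tendstoD)
  then show "\<forall>\<^sub>F x in F. f x \<in> U"
    using assms(2) by (simp add: U)
qed

text \<open>A map that is linear over \<open>J\<close> on both sides serves as both halves of a
  double centralizer.\<close>

lemma diagonal_multiplier:
  assumes "\<And>x. x \<in> J \<Longrightarrow> f x \<in> J"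
    and "\<And>x y. x \<in> J \<Longrightarrow> y \<in> J \<Longrightarrow> f (x + y) = f x + f y"
    and "\<And>c x. x \<in> J \<Longrightarrow> f (c *\<^sub>C x) = c *\<^sub>C f x"
    and "\<And>x. x \<in> J \<Longrightarrow> norm (f x) \<le> K * norm x"
    and "\<And>x y. x \<in> J \<Longrightarrow> y \<in> J \<Longrightarrow> f (x * y) = f x * y"
    and "\<And>x y. x \<in> J \<Longrightarrow> y \<in> J \<Longrightarrow> f (x * y) = x * f y"
    and "csubspace J" "\<And>x y. x \<in> J \<Longrightarrow> y \<in> J \<Longrightarrow> x * y \<in> J"
  shows "DC (restrict f J) (restrict f J) \<in> multiplier_algebra J"
proof -
  have "x + y \<in> J" "c *\<^sub>C x \<in> J" if "x \<in> J" "y \<in> J" for x y c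
    using that complex_vector.subspace_add complex_vector.subspace_scale assms(7) by blast+
  moreover have "\<exists>K. \<forall>x\<in>J. norm (f x) \<le> K * norm x"
    using assms(4) by blast
  ultimately have "bounded_clinear_on J (restrict f J)"
    using assms(2,3) by (simp add: bounded_clinear_on_def)
  moreover have "restrict f J x * y = x * restrict f J y" if "x \<in> J" "y \<in> J" for x y
    using assms(5,6)[OF that] that by simp
  ultimately show ?thesis
    using assms(1,5,6,8) by (auto simp: multiplier_algebra_def)
qed

lemma dc_embed_multiplier:
  assumes "b \<in> J" "csubspace J" "\<And>x y. x \<in> J \<Longrightarrow> y \<in> J \<Longrightarrow> x * y \<in> J"
  shows "dc_embed J b \<in> multiplier_algebra J"
proof -
  have "x + y \<in> J" "c *\<^sub>C x \<in> J" if "x \<in> J" "y \<in> J" for x y c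
    using that complex_vector.subspace_add complex_vector.subspace_scale assms(2) by blast+
  moreover have "\<exists>K. \<forall>x\<in>J. norm (b * x) \<le> K * norm x" "\<exists>K. \<forall>x\<in>J. norm (x * b) \<le> K * norm x"
    using norm_mult_ineq[of b] norm_mult_ineq[of _ b] by (auto simp: mult.commute intro: exI[of _ "norm b"])
  ultimately show ?thesis
    using assms(1,3)
    by (auto simp: dc_embed_def multiplier_algebra_def bounded_clinear_on_def mult.assoc
        algebra_simps mult_scaleC_left mult_scaleC_right)
qed

section \<open>The ideal spanned by a slice\<close>

lemma csubspace_imp_subspace: "csubspace S \<Longrightarrow> subspace S"
  unfolding subspace_def by (simp add: complex_vector.subspace_def scaleR_scaleC)

locale slice_expectation =
  fixes B M :: "'a::cstar_algebra set" and P :: "'a \<Rightarrow> 'a"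
  assumes subalgebra: "closed_star_subalgebra B"
    and approximate_unit: "contains_approximate_unit B"
    and expectation: "conditional_expectation B P"
    and slice: "slice B M"
begin

abbreviation R\<^sub>0 where "R\<^sub>0 \<equiv> cspan {m * adj n | m n. m \<in> M \<and> n \<in> M}"
abbreviation R where "R \<equiv> slice_range M"

lemma closed_B: "closed B" and csubspace_B: "csubspace B"
  and B_mult: "x \<in> B \<Longrightarrow> y \<in> B \<Longrightarrow> x * y \<in> B"
  and B_adj: "x \<in> B \<Longrightarrow> adj x \<in> B"
  using subalgebra by (auto simp: closed_star_subalgebra_def)

lemma csubspace_M: "csubspace M"
  and BM: "b \<in> B \<Longrightarrow> m \<in> M \<Longrightarrow> b * m \<in> M"
  using slice by (auto simp: slice_def)

lemma M_conj: "m \<in> M \<Longrightarrow> b \<in> B \<Longrightarrow> adj m * b * m \<in> B"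
  "m \<in> M \<Longrightarrow> b \<in> B \<Longrightarrow> m * b * adj m \<in> B"
  using slice by (auto simp: slice_def normalizer_def)

lemma M_add: "m \<in> M \<Longrightarrow> n \<in> M \<Longrightarrow> m + n \<in> M"
  and M_diff: "m \<in> M \<Longrightarrow> n \<in> M \<Longrightarrow> m - n \<in> M"
  and M_scaleC: "m \<in> M \<Longrightarrow> c *\<^sub>C m \<in> M"
  and M_scaleR: "m \<in> M \<Longrightarrow> r *\<^sub>R m \<in> M"
  using complex_vector.subspace_add complex_vector.subspace_diff complex_vector.subspace_scale csubspace_M
  by (auto simp: scaleR_scaleC)

lemma P_add: "P (x + y) = P x + P y" and P_diff: "P (x - y) = P x - P y"
  and P_scaleC: "P (c *\<^sub>C x) = c *\<^sub>C P x"
proof -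
  have "Vector_Spaces.linear scaleC scaleC P"
    using expectation by (simp add: conditional_expectation_def)
  then interpret Vector_Spaces.linear scaleC scaleC P .
  show "P (x + y) = P x + P y" "P (x - y) = P x - P y" "P (c *\<^sub>C x) = c *\<^sub>C P x"
    by (simp_all add: add diff scale)
qed

lemma P_in: "P x \<in> B"
  and P_B: "b \<in> B \<Longrightarrow> P b = b"
  and P_left: "b \<in> B \<Longrightarrow> P (b * a) = b * P a"
  and P_right: "b \<in> B \<Longrightarrow> P (a * b) = P a * b"
  and P_positive: "positive a \<Longrightarrow> positive (P a)"
  and P_norm: "norm (P a) \<le> norm a"
  using expectation by (auto simp: conditional_expectation_def)

lemma bounded_linear_P: "bounded_linear P"
  by (rule bounded_linear_intro[where K = 1]) (simp_all add: P_add P_scaleC scaleR_scaleC P_norm)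

lemma obtain_approximate_unit:
  obtains F :: "'a filter" where "F \<noteq> bot" "\<forall>\<^sub>F e in F. e \<in> B \<and> positive e"
    "\<And>a. ((\<lambda>e. e * a) \<longlongrightarrow> a) F" "\<And>a. ((\<lambda>e. a * e) \<longlongrightarrow> a) F"
proof -
  obtain F :: "'a filter" where F: "F \<noteq> bot" "\<forall>\<^sub>F e in F. e \<in> B \<and> positive e \<and> norm e \<le> 1"
    "\<And>a. ((\<lambda>e. e * a) \<longlongrightarrow> a) F" "\<And>a. ((\<lambda>e. a * e) \<longlongrightarrow> a) F"
    using approximate_unit by (auto simp: contains_approximate_unit_def)
  from F(2) have "\<forall>\<^sub>F e in F. e \<in> B \<and> positive e"
    by (rule eventually_mono) simp
  with F that show thesis by blast
qed

text \<open>The normalizer condition covers only \<open>adj a * e * a\<close>. Polarization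
  separates the two outer factors, and \<open>e\<close> then runs through the approximate
  unit.\<close>

lemma adj_mult_in_B:
  assumes "a \<in> M" "b \<in> M"
  shows "adj a * b \<in> B"
proof -
  obtain F :: "'a filter" where F: "F \<noteq> bot" "\<forall>\<^sub>F e in F. e \<in> B \<and> positive e"
    "\<And>a. ((\<lambda>e. e * a) \<longlongrightarrow> a) F" "\<And>a. ((\<lambda>e. a * e) \<longlongrightarrow> a) F"
    using obtain_approximate_unit by blast
  have "adj a * e * b \<in> B" if "e \<in> B" for e
    by (rule polarization[where s = "\<lambda>a b. adj a * e * b" and k = \<i>], rule csubspace_B,
        (auto intro!: M_conj M_add M_scaleC that assms)[4])
      (simp_all add: algebra_simps adj_add adj_scaleC mult_scaleC_left mult_scaleC_right scaleC_scaleC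
        scaleC_minus1 scaleC_one)
  then have "\<forall>\<^sub>F e in F. adj a * (e * b) \<in> B"
    using F(2) by (auto elim!: eventually_mono simp: mult.assoc)
  then show ?thesis
    by (intro Lim_in_closed_set[OF closed_B _ F(1)]) (auto intro!: tendsto_intros F)
qed

lemma mult_adj_in_B:
  assumes "a \<in> M" "b \<in> M"
  shows "a * adj b \<in> B"
proof -
  obtain F :: "'a filter" where F: "F \<noteq> bot" "\<forall>\<^sub>F e in F. e \<in> B \<and> positive e"
    "\<And>a. ((\<lambda>e. e * a) \<longlongrightarrow> a) F" "\<And>a. ((\<lambda>e. a * e) \<longlongrightarrow> a) F"
    using obtain_approximate_unit by blast
  have "a * e * adj b \<in> B" if "e \<in> B" for e
    by (rule polarization[where s = "\<lambda>a b. a * e * adj b" and k = "- \<i>"], rule csubspace_B,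
        (auto intro!: M_conj M_add M_scaleC that assms)[4])
      (simp_all add: algebra_simps adj_add adj_scaleC mult_scaleC_left mult_scaleC_right scaleC_scaleC
        scaleC_minus1 scaleC_one)
  then have "\<forall>\<^sub>F e in F. a * (e * adj b) \<in> B"
    using F(2) by (auto elim!: eventually_mono simp: mult.assoc)
  then show ?thesis
    by (intro Lim_in_closed_set[OF closed_B _ F(1)]) (auto intro!: tendsto_intros F)
qed

lemma positive_adj: "positive a \<Longrightarrow> adj a = a"
  by (auto simp: positive_def adj_mult adj_adj)

lemma P_adj: "P (adj a) = adj (P a)"
proof -
  obtain F :: "'a filter" where F: "F \<noteq> bot" "\<forall>\<^sub>F e in F. e \<in> B \<and> positive e"
    "\<And>a. ((\<lambda>e. e * a) \<longlongrightarrow> a) F" "\<And>a. ((\<lambda>e. a * e) \<longlongrightarrow> a) F"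
    using obtain_approximate_unit by blast
  have pos: "positive (adj c * c)" for c :: 'a
    by (auto simp: positive_def)
  \<comment> \<open>The sesquilinear defect P(a* b) - P(b* a)* vanishes on the diagonal, because
    positive elements are self-adjoint; polarizing into the zero subspace makes it vanish
    everywhere.\<close>
  have "P (adj e * a) - adj (P (adj a * e)) \<in> {0}" for e
    by (rule polarization[where s = "\<lambda>a b. P (adj a * b) - adj (P (adj b * a))" and k = \<i>],
        rule complex_vector.subspace_single_0, (simp_all add: positive_adj[OF P_positive[OF pos]])[4])
      (simp_all add: algebra_simps adj_add adj_diff adj_scaleC mult_scaleC_left mult_scaleC_right
        P_add P_diff P_scaleC complex_vector.scale_right_diff_distrib scaleC_add_right scaleC_scaleC
        scaleC_minus1 scaleC_one)
  then have eq: "adj (P (adj a * e)) = P (adj e * a)" for e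
    by simp
  have "\<forall>\<^sub>F e in F. adj (P (adj a * e)) = P (e * a)"
    using F(2) by eventually_elim (simp add: eq positive_adj)
  moreover have "((\<lambda>e. adj (P (adj a * e))) \<longlongrightarrow> adj (P (adj a))) F"
    by (intro tendsto_adj bounded_linear.tendsto[OF bounded_linear_P] F)
  ultimately have "((\<lambda>e. P (e * a)) \<longlongrightarrow> adj (P (adj a))) F"
    by (rule Lim_transform_eventually[rotated])
  moreover have "((\<lambda>e. P (e * a)) \<longlongrightarrow> P a) F"
    by (intro bounded_linear.tendsto[OF bounded_linear_P] F)
  ultimately have "adj (P (adj a)) = P a"
    using tendsto_unique[OF F(1)] by blast
  then show ?thesis by (metis adj_adj)
qed

section \<open>The range ideal and its approximate unit\<close>

lemma csubspace_R: "csubspace R"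
  unfolding slice_range_def by (rule csubspace_closure) (rule complex_vector.subspace_span)

lemma closed_R: "closed R"
  by (simp add: slice_range_def)

lemma R0_subset: "R\<^sub>0 \<subseteq> R"
  by (simp add: slice_range_def closure_subset)

lemma R_gen: "m \<in> M \<Longrightarrow> n \<in> M \<Longrightarrow> m * adj n \<in> R"
  using R0_subset complex_vector.span_base[of "m * adj n" "{m * adj n | m n. m \<in> M \<and> n \<in> M}"] by blast

lemma R_add: "x \<in> R \<Longrightarrow> y \<in> R \<Longrightarrow> x + y \<in> R"
  and R_diff: "x \<in> R \<Longrightarrow> y \<in> R \<Longrightarrow> x - y \<in> R"
  and R_scaleC: "x \<in> R \<Longrightarrow> c *\<^sub>C x \<in> R"
  and R_0: "0 \<in> R"
  using complex_vector.subspace_add complex_vector.subspace_diff complex_vector.subspace_scale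
    complex_vector.subspace_0 csubspace_R by blast+

lemma R0_induct:
  assumes "z \<in> R\<^sub>0" "csubspace {z. Q z}" "\<And>m n. m \<in> M \<Longrightarrow> n \<in> M \<Longrightarrow> Q (m * adj n)"
  shows "Q z"
  using complex_vector.span_minimal[OF _ assms(2), of "{m * adj n | m n. m \<in> M \<and> n \<in> M}"] assms(1,3)
  by blast

lemma R_induct:
  assumes "z \<in> R" "closed {z. Q z}" "csubspace {z. Q z}" "\<And>m n. m \<in> M \<Longrightarrow> n \<in> M \<Longrightarrow> Q (m * adj n)"
  shows "Q z"
proof -
  have "R \<subseteq> {z. Q z}"
    unfolding slice_range_def using R0_induct[OF _ assms(3,4)] assms(2)
    by (intro closure_minimal) auto
  then show ?thesis using assms(1) by blast
qed

lemma R_subset_B: "z \<in> R \<Longrightarrow> z \<in> B"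
  by (rule R_induct) (auto simp: closed_B csubspace_B mult_adj_in_B)

lemma B_R:
  assumes "b \<in> B" "z \<in> R"
  shows "b * z \<in> R"
proof (rule R_induct[OF assms(2)])
  show "closed {z. b * z \<in> R}"
    using continuous_closed_vimage[OF closed_R, of "\<lambda>z. b * z"] by (auto simp: vimage_def)
  show "csubspace {z. b * z \<in> R}"
    by (rule complex_vector.subspaceI) (auto simp: algebra_simps mult_scaleC_right R_add R_scaleC R_0)
qed (auto simp: mult.assoc[symmetric] intro!: R_gen BM assms)

lemma R_adj:
  assumes "z \<in> R"
  shows "adj z \<in> R"
proof (rule R_induct[OF assms])
  have "isCont (adj :: 'a \<Rightarrow> 'a) x" for x
    by (rule linear_continuous_at[OF bounded_linear_adj])
  then show "closed {z. adj z \<in> R}"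
    using continuous_closed_vimage[OF closed_R, of adj] by (auto simp: vimage_def)
  show "csubspace {z. adj z \<in> R}"
    by (rule complex_vector.subspaceI) (auto simp: adj_add adj_scaleC R_add R_scaleC R_0)
qed (auto simp: adj_mult adj_adj intro!: R_gen)

lemma R_B: "z \<in> R \<Longrightarrow> b \<in> B \<Longrightarrow> z * b \<in> R"
  using R_adj[OF B_R[OF B_adj R_adj]] by (simp add: adj_mult adj_adj)

lemma R_mult: "x \<in> R \<Longrightarrow> y \<in> R \<Longrightarrow> x * y \<in> R"
  using B_R R_subset_B by blast

text \<open>Lists keep repetitions, so mapping a function over the vectors cannot merge
  terms.\<close>

definition gram :: "'a list \<Rightarrow> 'a" where
  "gram xs = (\<Sum>x\<leftarrow>xs. x * adj x)"

definition gram_P :: "'a list \<Rightarrow> 'a" where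
  "gram_P xs = (\<Sum>x\<leftarrow>xs. P x * P (adj x))"

lemma gram_simps [simp]: "gram [] = 0" "gram (x # xs) = x * adj x + gram xs"
  "gram_P [] = 0" "gram_P (x # xs) = P x * P (adj x) + gram_P xs"
  by (simp_all add: gram_def gram_P_def)

lemma adj_gram: "adj (gram xs) = gram xs"
  by (induction xs) (simp_all add: adj_add adj_mult adj_adj)

lemma gram_in_R: "set xs \<subseteq> M \<Longrightarrow> gram xs \<in> R"
  by (induction xs) (auto intro!: R_add R_gen R_0)

lemma psd_gram: "psd (gram xs)"
  by (induction xs) (simp_all add: psd_0 psd_add psd_mult_adj)

lemma psd_gram_minus: "x \<in> set xs \<Longrightarrow> psd (gram xs - x * adj x)"
proof (induction xs)
  case (Cons y xs)
  show ?case
  proof (cases "x = y")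
    case False
    then have "psd (y * adj y + (gram xs - x * adj x))"
      using Cons by (intro psd_add psd_mult_adj) auto
    then show ?thesis by (simp add: algebra_simps)
  qed (simp add: psd_gram)
qed simp

text \<open>With \<open>g = (3 - d) / 2\<close>, a Newton step is \<open>g d g\<close>; hence it preserves the form \<open>\<Sum> x x\<^sup>*\<close>.\<close>

lemma newton_step_gram:
  assumes "set xs \<subseteq> M"
  shows "\<exists>ys. set ys \<subseteq> M \<and> gram ys = newton_step (gram xs)"
proof (intro exI conjI)
  define g where "g x = (3 / 2) *\<^sub>R x - (1 / 2) *\<^sub>R (gram xs * x)" for x
  show "set (map g xs) \<subseteq> M"
    using assms R_subset_B[OF gram_in_R[OF assms]] by (auto simp: g_def intro!: M_diff M_scaleR BM)
  have quarters: "(3 / 2) *\<^sub>R y = (3 / 4) *\<^sub>R y + (3 / 4) *\<^sub>R y" for y :: 'a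
    by (simp flip: scaleR_left_distrib)
  have "gram (map g ys) = (9 / 4) *\<^sub>R gram ys - (3 / 4) *\<^sub>R (gram xs * gram ys)
      - (3 / 4) *\<^sub>R (gram ys * gram xs) + (1 / 4) *\<^sub>R (gram xs * gram ys * gram xs)" for ys
    by (induction ys) (simp_all add: g_def adj_diff adj_scaleR adj_mult adj_gram algebra_simps)
  from this[of xs] show "gram (map g xs) = newton_step (gram xs)"
    unfolding newton_step_def quarters[of "gram xs * gram xs"] by simp
qed

text \<open>\<open>gram xs\<close> dominates every \<open>x * adj x\<close> with \<open>x\<close> in
  the list, so a single iteration serves all of these vectors at once.\<close>

lemma gram_approximate_unit:
  assumes "set xs \<subseteq> M"
  obtains c where "\<And>n. set (c n) \<subseteq> M" "\<And>n. norm (gram (c n)) \<le> 1"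
    "\<And>x. x \<in> set xs \<Longrightarrow> (\<lambda>n. gram (c n) * x) \<longlonglongrightarrow> x"
proof -
  \<comment> \<open>Scaling the vectors by r multiplies \<open>gram xs\<close> by r^2; this r gives
    norm at most 1 without extracting a root.\<close>
  define r where "r = 1 / (1 + norm (gram xs))"
  have r: "r > 0" by (auto simp: r_def intro!: divide_pos_pos add_pos_nonneg)
  have "1 + norm (gram xs) > 0" by (simp add: add_pos_nonneg)
  then have r1: "r * norm (gram xs) \<le> 1" "r \<le> 1" by (simp_all add: r_def)
  define ys where "ys = map (\<lambda>x. r *\<^sub>R x) xs"
  have "gram ys = r *\<^sub>R r *\<^sub>R gram xs"
    unfolding ys_def by (induction xs) (simp_all add: adj_scaleR algebra_simps)
  then have "norm (gram ys) = r * (r * norm (gram xs))" using r by simp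
  then have norm: "norm (gram ys) \<le> 1"
    using mult_le_one[of r "r * norm (gram xs)"] r r1 by simp
  have ys: "set ys \<subseteq> M" using assms by (auto simp: ys_def M_scaleR)
  have "\<exists>zs. set zs \<subseteq> M \<and> gram zs = (newton_step ^^ n) (gram ys)" for n
  proof (induction n)
    case (Suc n)
    then show ?case using newton_step_gram by fastforce
  qed (use ys in auto)
  then obtain c where c: "\<And>n. set (c n) \<subseteq> M" "\<And>n. gram (c n) = (newton_step ^^ n) (gram ys)"
    by metis
  show thesis
  proof (rule that[of c])
    show "norm (gram (c n)) \<le> 1" for n
      unfolding c(2) by (rule newton_norm_le[OF psd_gram norm])
    fix x assume "x \<in> set xs"
    then have "r *\<^sub>R x \<in> set ys" by (auto simp: ys_def)
    then have "(\<lambda>n. gram (c n) * (r *\<^sub>R x)) \<longlonglongrightarrow> r *\<^sub>R x"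
      unfolding c(2) by (intro newton_mult_tendsto psd_gram norm psd_gram_minus)
    then have "(\<lambda>n. (1 / r) *\<^sub>R (gram (c n) * (r *\<^sub>R x))) \<longlonglongrightarrow> (1 / r) *\<^sub>R (r *\<^sub>R x)"
      by (intro tendsto_intros)
    then show "(\<lambda>n. gram (c n) * x) \<longlonglongrightarrow> x" using r by simp
  qed (rule c(1))
qed

text \<open>Approximate \<open>m\<close> by \<open>gram (c n) * m\<close>: the factor lies in
  \<open>B\<close>, so \<open>P\<close> moves past it and the value lies in the ideal.\<close>

lemma P_in_R: "m \<in> M \<Longrightarrow> P m \<in> R"
proof -
  assume m: "m \<in> M"
  then have "set [m] \<subseteq> M" by simp
  then obtain c where c: "\<And>n. set (c n) \<subseteq> M" "\<And>n. norm (gram (c n)) \<le> 1"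
    "\<And>x. x \<in> set [m] \<Longrightarrow> (\<lambda>n. gram (c n) * x) \<longlonglongrightarrow> x"
    by (rule gram_approximate_unit) blast
  have "(\<lambda>n. P (gram (c n) * m)) \<longlonglongrightarrow> P m"
    by (intro bounded_linear.tendsto[OF bounded_linear_P] c) simp
  then show ?thesis
    by (rule closed_sequentially[OF closed_R, rotated])
      (simp add: P_left R_subset_B[OF gram_in_R[OF c(1)]] R_B[OF gram_in_R[OF c(1)] P_in])
qed

lemma P_adj_in_R: "m \<in> M \<Longrightarrow> P (adj m) \<in> R"
  by (simp add: P_adj R_adj P_in_R)

lemma gram_approximate_unit_R:
  assumes "z \<in> R" "\<epsilon> > 0"
  obtains xs where "set xs \<subseteq> M" "norm (gram xs) \<le> 1" "norm (z - z * gram xs) < \<epsilon>"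
proof -
  obtain z' where z': "z' \<in> R\<^sub>0" "dist z' z < \<epsilon> / 3"
    using assms unfolding slice_range_def closure_approachable by (meson divide_pos_pos zero_less_numeral)
  \<comment> \<open>Quantifying over all self-adjoint sequences that act as a unit on the list makes
    the property additive: for a sum the lists are concatenated. Self-adjointness turns c n -> n
    into convergence on the right of m n*.\<close>
  have "\<exists>xs. set xs \<subseteq> M \<and> (\<forall>c. (\<forall>n. adj (c n) = c n) \<longrightarrow>
    (\<forall>x\<in>set xs. (\<lambda>n::nat. c n * x) \<longlonglongrightarrow> x) \<longrightarrow> (\<lambda>n. z' * c n) \<longlonglongrightarrow> z')" (is "\<exists>xs. ?Q z' xs")
  proof (rule R0_induct[OF z'(1)])
    show "csubspace {z. \<exists>xs. ?Q z xs}"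
    proof (rule complex_vector.subspaceI)
      show "0 \<in> {z. \<exists>xs. ?Q z xs}" by (auto intro: exI[of _ "[]"])
      fix x y k
      assume "x \<in> {z. \<exists>xs. ?Q z xs}" "y \<in> {z. \<exists>xs. ?Q z xs}"
      then obtain xs ys where xs: "?Q x xs" and ys: "?Q y ys" by blast
      have "?Q (x + y) (xs @ ys)"
        using xs ys by (auto simp: distrib_right intro!: tendsto_add)
      then show "x + y \<in> {z. \<exists>xs. ?Q z xs}" by blast
      have "?Q (k *\<^sub>C x) xs"
        using xs by (auto simp: mult_scaleC_left intro!: bounded_linear.tendsto[OF bounded_linear_scaleC])
      then show "k *\<^sub>C x \<in> {z. \<exists>xs. ?Q z xs}" by blast
    qed
    fix m n assume mn: "m \<in> M" "n \<in> M"
    have "(\<lambda>i. m * adj n * c i) \<longlonglongrightarrow> m * adj n"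
      if "\<forall>i. adj (c i) = c i" "(\<lambda>i::nat. c i * n) \<longlonglongrightarrow> n" for c
      using tendsto_mult[OF tendsto_const tendsto_adj[OF that(2)], of m] that(1)
      by (simp add: adj_mult mult.assoc)
    then have "?Q (m * adj n) [n]" using mn by auto
    then show "\<exists>xs. ?Q (m * adj n) xs" by blast
  qed
  then obtain xs where xs: "?Q z' xs" by blast
  obtain c where c: "\<And>n. set (c n) \<subseteq> M" "\<And>n. norm (gram (c n)) \<le> 1"
    "\<And>x. x \<in> set xs \<Longrightarrow> (\<lambda>n. gram (c n) * x) \<longlonglongrightarrow> x"
    by (rule gram_approximate_unit[OF conjunct1[OF xs]]) blast
  have "(\<lambda>n. z' * gram (c n)) \<longlonglongrightarrow> z'"
    by (rule conjunct2[OF xs, rule_format, of "\<lambda>n. gram (c n)"]) (simp_all add: adj_gram c(3))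
  then obtain n where n: "dist (z' * gram (c n)) z' < \<epsilon> / 3"
    using assms(2) unfolding lim_sequentially by (meson divide_pos_pos order_refl zero_less_numeral)
  have le: "norm ((z' - z) * gram (c n)) \<le> norm (z' - z)"
    using norm_mult_ineq[of "z' - z" "gram (c n)"] mult_left_mono[OF c(2)[of n], of "norm (z' - z)"] by simp
  have eq: "z - z * gram (c n) = (z - z') + ((z' - z' * gram (c n)) + (z' - z) * gram (c n))"
    by (simp add: algebra_simps)
  have "norm (z - z * gram (c n)) \<le>
      norm (z - z') + (norm (z' - z' * gram (c n)) + norm ((z' - z) * gram (c n)))"
    by (subst eq) (rule order_trans[OF norm_triangle_ineq add_left_mono[OF norm_triangle_ineq]])
  with le have "norm (z - z * gram (c n)) < \<epsilon>"
    using z'(2) n norm_minus_commute[of z z'] norm_minus_commute[of z' "z' * gram (c n)"]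
    unfolding dist_norm by linarith
  then show thesis using that[of "c n"] c by blast
qed

section \<open>Order estimates for the expectation\<close>

lemma psd_gram_P: "psd (gram_P xs)"
  by (induction xs) (simp_all add: psd_0 psd_add psd_mult_adj P_adj)

lemma psd_gram_diff: "set xs \<subseteq> M \<Longrightarrow> psd (gram xs - gram_P xs)"
proof (induction xs)
  case (Cons x xs)
  \<comment> \<open>Since x x* lies in \<open>B\<close>, \<open>P\<close> fixes it; each mixed term
    contributes P x P x*.\<close>
  then have "x * adj x \<in> B" by (auto intro: mult_adj_in_B)
  then have "P ((x - P x) * adj (x - P x)) = x * adj x - P x * P (adj x)"
    by (simp add: adj_diff left_diff_distrib right_diff_distrib P_diff P_B P_left P_right P_in B_mult B_adj P_adj)
  moreover have "positive ((x - P x) * adj (x - P x))"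
    unfolding positive_def by (metis adj_adj)
  ultimately have "psd (x * adj x - P x * P (adj x))"
    by (metis P_positive psd_positive)
  moreover have "psd (gram xs - gram_P xs)" using Cons by simp
  ultimately have "psd ((x * adj x - P x * P (adj x)) + (gram xs - gram_P xs))"
    by (rule psd_add)
  then show ?case by (simp add: algebra_simps)
qed (simp add: psd_0)

lemma norm_gram_P_le: "set xs \<subseteq> M \<Longrightarrow> norm (gram_P xs) \<le> norm (gram xs)"
  and norm_gram_diff_le: "set xs \<subseteq> M \<Longrightarrow> norm (gram xs - gram_P xs) \<le> norm (gram xs)"
  using psd_norm_mono[OF psd_gram_P psd_gram_diff, of xs xs]
    psd_norm_mono[OF psd_gram_diff psd_gram_P, of xs xs] by simp_all

end

section \<open>The central multiplier\<close>

context slice_expectation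
begin

text \<open>Moving the elements \<open>m n\<^sup>*\<close> and \<open>n\<^sup>* x\<close> of \<open>B\<close> in and out of \<open>P\<close> in two ways makes
  \<open>m n\<^sup>* \<mapsto> P m P n\<^sup>*\<close> symmetric; this forces it to be a well-defined centralizer.\<close>

lemma P_exchange:
  assumes "m \<in> M" "n \<in> M" "x \<in> M" "y \<in> M"
  shows "P m * P (adj n) * (x * adj y) = m * adj n * (P x * P (adj y))"
proof -
  have "P (adj n) * (x * adj y) = P (adj n * x * adj y)"
    by (simp add: P_right mult_adj_in_B assms mult.assoc)
  also have "\<dots> = adj n * x * P (adj y)"
    by (simp add: P_left adj_mult_in_B assms)
  finally have "P m * P (adj n) * (x * adj y) = P (m * (adj n * x)) * P (adj y)"
    by (simp add: P_right adj_mult_in_B assms mult.assoc)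
  also have "P (m * (adj n * x)) = m * adj n * P x"
    by (simp add: P_left mult_adj_in_B assms mult.assoc[symmetric])
  finally show ?thesis by (simp add: mult.assoc)
qed

text \<open>The graph of the multiplier, tested against generators. Unlike a formula on a chosen
  decomposition into generators, it is linear and closed by its form; being single-valued becomes a
  norm estimate.\<close>

definition tau_rel :: "'a \<Rightarrow> 'a \<Rightarrow> bool" where
  "tau_rel z w \<longleftrightarrow> z \<in> R \<and> w \<in> R \<and>
    (\<forall>x\<in>M. \<forall>y\<in>M. w * (x * adj y) = z * (P x * P (adj y)))"

lemma tau_rel_gen: "m \<in> M \<Longrightarrow> n \<in> M \<Longrightarrow> tau_rel (m * adj n) (P m * P (adj n))"
  by (simp add: tau_rel_def P_exchange R_gen R_mult P_in_R P_adj_in_R)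

lemma tau_rel_0: "tau_rel 0 0"
  and tau_rel_add: "tau_rel z w \<Longrightarrow> tau_rel z' w' \<Longrightarrow> tau_rel (z + z') (w + w')"
  and tau_rel_diff: "tau_rel z w \<Longrightarrow> tau_rel z' w' \<Longrightarrow> tau_rel (z - z') (w - w')"
  and tau_rel_scaleC: "tau_rel z w \<Longrightarrow> tau_rel (c *\<^sub>C z) (c *\<^sub>C w)"
  and tau_rel_mult: "b \<in> B \<Longrightarrow> tau_rel z w \<Longrightarrow> tau_rel (b * z) (b * w)"
  by (simp_all add: tau_rel_def R_0 R_add R_diff R_scaleC B_R distrib_right left_diff_distrib
      mult_scaleC_left mult.assoc)

lemma tau_rel_gram:
  assumes "tau_rel z w" "set xs \<subseteq> M"
  shows "w * gram xs = z * gram_P xs"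
  using assms(2) by (induction xs) (use assms(1) in \<open>auto simp: tau_rel_def distrib_left\<close>)

lemma tau_rel_norm:
  assumes "tau_rel z w"
  shows "norm w \<le> norm z" "norm (z - w) \<le> norm z"
proof -
  \<comment> \<open>Used for \<open>v = w\<close> and for \<open>v = z - w\<close>, with
    \<open>gram_P xs\<close> and \<open>gram xs - gram_P xs\<close> as the respective right factors
    of \<open>z\<close>.\<close>
  have bound: "norm v \<le> norm z"
    if "v \<in> R" and v: "\<And>xs. set xs \<subseteq> M \<Longrightarrow> norm (v * gram xs) \<le> norm z * norm (gram xs)" for v
  proof (rule field_le_epsilon)
    fix \<epsilon> :: real assume "\<epsilon> > 0"
    obtain xs where xs: "set xs \<subseteq> M" "norm (gram xs) \<le> 1" "norm (v - v * gram xs) < \<epsilon>"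
      by (rule gram_approximate_unit_R[OF \<open>v \<in> R\<close> \<open>\<epsilon> > 0\<close>]) blast
    have "norm (v * gram xs) \<le> norm z"
      using v[OF xs(1)] mult_left_mono[OF xs(2), of "norm z"] by simp
    then show "norm v \<le> norm z + \<epsilon>"
      using norm_triangle_sub[of v "v * gram xs"] xs(3) by simp
  qed
  show "norm w \<le> norm z"
  proof (rule bound)
    fix xs assume xs: "set xs \<subseteq> M"
    show "norm (w * gram xs) \<le> norm z * norm (gram xs)"
      unfolding tau_rel_gram[OF assms xs]
      by (rule order_trans[OF norm_mult_ineq mult_left_mono[OF norm_gram_P_le[OF xs]]]) simp
  qed (use assms in \<open>simp add: tau_rel_def\<close>)
  show "norm (z - w) \<le> norm z"
  proof (rule bound)
    fix xs assume xs: "set xs \<subseteq> M"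
    have "(z - w) * gram xs = z * (gram xs - gram_P xs)"
      by (simp add: algebra_simps tau_rel_gram[OF assms xs])
    then show "norm ((z - w) * gram xs) \<le> norm z * norm (gram xs)"
      using order_trans[OF norm_mult_ineq mult_left_mono[OF norm_gram_diff_le[OF xs], of "norm z"]] by simp
  qed (use assms in \<open>simp add: tau_rel_def R_diff\<close>)
qed

text \<open>The difference of two values is related to 0, so its norm is at most 0.\<close>

lemma tau_rel_unique: "tau_rel z w \<Longrightarrow> tau_rel z w' \<Longrightarrow> w = w'"
  using tau_rel_norm(1)[OF tau_rel_diff[of z w z w']] by simp

lemma tau_rel_tendsto:
  assumes "\<And>n. tau_rel (f n) (g n)" "f \<longlonglongrightarrow> z" "g \<longlonglongrightarrow> w"
  shows "tau_rel z w"
  unfolding tau_rel_def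
proof (intro conjI ballI)
  show "z \<in> R" "w \<in> R"
    using assms(1) closed_sequentially[OF closed_R _ assms(2)] closed_sequentially[OF closed_R _ assms(3)]
    by (simp_all add: tau_rel_def)
  fix x y assume "x \<in> M" "y \<in> M"
  have "(\<lambda>n. g n * (x * adj y)) \<longlonglongrightarrow> w * (x * adj y)"
    by (intro tendsto_intros assms)
  moreover have "(\<lambda>n. f n * (P x * P (adj y))) \<longlonglongrightarrow> z * (P x * P (adj y))"
    by (intro tendsto_intros assms)
  moreover have "g n * (x * adj y) = f n * (P x * P (adj y))" for n
    using assms(1)[of n] \<open>x \<in> M\<close> \<open>y \<in> M\<close> by (simp add: tau_rel_def)
  ultimately show "w * (x * adj y) = z * (P x * P (adj y))"
    using LIMSEQ_unique by simp
qed

text \<open>The relation is contractive, so values along a convergent sequence are Cauchy, and the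
  graph is closed.\<close>

lemma tau_rel_total: "z \<in> R \<Longrightarrow> \<exists>w. tau_rel z w"
proof -
  assume "z \<in> R"
  then obtain f where f: "\<And>n. f n \<in> R\<^sub>0" "f \<longlonglongrightarrow> z"
    unfolding slice_range_def closure_sequential by blast
  have "\<exists>w. tau_rel z w" if "z \<in> R\<^sub>0" for z
  proof (rule R0_induct[OF that])
    show "csubspace {z. \<exists>w. tau_rel z w}"
      by (rule complex_vector.subspaceI) (use tau_rel_0 tau_rel_add tau_rel_scaleC in blast)+
  qed (use tau_rel_gen in blast)
  then have "\<forall>n. \<exists>w. tau_rel (f n) w"
    by (simp add: f(1))
  then obtain g where g: "\<And>n. tau_rel (f n) (g n)"
    by (auto dest!: choice)
  have "norm (g m - g n) \<le> norm (f m - f n)" for m n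
    using tau_rel_norm(1)[OF tau_rel_diff[OF g g]] .
  moreover have "Cauchy f" using f(2) LIMSEQ_imp_Cauchy by blast
  ultimately have "Cauchy g"
    unfolding Cauchy_def dist_norm by (meson order_le_less_trans)
  then obtain w where "g \<longlonglongrightarrow> w" using Cauchy_convergent convergent_def by blast
  then show ?thesis using tau_rel_tendsto[OF g f(2)] by blast
qed

section \<open>The multiplier as a map on the ideal\<close>

definition tau :: "'a \<Rightarrow> 'a" where
  "tau z = (THE w. tau_rel z w)"

lemma tau_eq: "tau_rel z w \<Longrightarrow> tau z = w"
  unfolding tau_def by (blast intro: tau_rel_unique)

lemma tau_rel_tau: "z \<in> R \<Longrightarrow> tau_rel z (tau z)"
  using tau_rel_total tau_eq by blast

lemma tau_in_R: "z \<in> R \<Longrightarrow> tau z \<in> R"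
  using tau_rel_tau by (auto simp: tau_rel_def)

lemma tau_gen: "m \<in> M \<Longrightarrow> n \<in> M \<Longrightarrow> tau (m * adj n) = P m * P (adj n)"
  by (rule tau_eq) (rule tau_rel_gen)

lemma tau_add: "x \<in> R \<Longrightarrow> y \<in> R \<Longrightarrow> tau (x + y) = tau x + tau y"
  and tau_diff: "x \<in> R \<Longrightarrow> y \<in> R \<Longrightarrow> tau (x - y) = tau x - tau y"
  and tau_scaleC: "x \<in> R \<Longrightarrow> tau (c *\<^sub>C x) = c *\<^sub>C tau x"
  and tau_mult_right: "x \<in> R \<Longrightarrow> y \<in> R \<Longrightarrow> tau (x * y) = x * tau y"
  by (intro tau_eq tau_rel_add tau_rel_diff tau_rel_scaleC tau_rel_mult tau_rel_tau R_subset_B; assumption)+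

lemma tau_norm: "x \<in> R \<Longrightarrow> norm (tau x) \<le> norm x"
  and tau_complement_norm: "x \<in> R \<Longrightarrow> norm (x - tau x) \<le> norm x"
  using tau_rel_norm[OF tau_rel_tau] by blast+

lemma tau_tendsto:
  assumes "\<And>n. f n \<in> R" "f \<longlonglongrightarrow> z"
  shows "z \<in> R" "(\<lambda>n. tau (f n)) \<longlonglongrightarrow> tau z"
proof -
  show z: "z \<in> R" using closed_sequentially[OF closed_R assms] .
  have "(\<lambda>n. tau (f n - z)) \<longlonglongrightarrow> 0"
  proof (rule Lim_null_comparison)
    show "\<forall>\<^sub>F n in sequentially. norm (tau (f n - z)) \<le> norm (f n - z)"
      by (intro always_eventually allI tau_norm R_diff assms z)
    show "(\<lambda>n. norm (f n - z)) \<longlonglongrightarrow> 0"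
      using assms(2) by (simp add: LIM_zero tendsto_norm_zero)
  qed
  then show "(\<lambda>n. tau (f n)) \<longlonglongrightarrow> tau z"
    by (simp add: tau_diff assms(1) z LIM_zero_cancel)
qed

text \<open>Continuity is asked only along sequences in \<open>R\<close>, since \<open>tau\<close>
  is unspecified elsewhere. Homogeneity is asked only at zeros, which also admits the
  conjugate-linear \<open>g\<close> needed for adjoints.\<close>

lemma R_eq_induct:
  assumes z: "z \<in> R"
    and lim: "\<And>f z. (\<And>n. f n \<in> R) \<Longrightarrow> f \<longlonglongrightarrow> z \<Longrightarrow> (\<lambda>n. g (f n)) \<longlonglongrightarrow> g z"
    and g: "\<And>x y. x \<in> R \<Longrightarrow> y \<in> R \<Longrightarrow> g (x + y) = g x + g y"
      "\<And>c x. x \<in> R \<Longrightarrow> g x = 0 \<Longrightarrow> g (c *\<^sub>C x) = (0::'a)"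
    and gen: "\<And>m n. m \<in> M \<Longrightarrow> n \<in> M \<Longrightarrow> g (m * adj n) = 0"
  shows "g z = 0"
proof -
  have "z \<in> R \<and> g z = 0"
  proof (rule R_induct[OF z])
    show "closed {z. z \<in> R \<and> g z = 0}"
      unfolding closed_sequential_limits
    proof (intro allI impI, elim conjE)
      fix f l assume f: "\<forall>n. f n \<in> {z. z \<in> R \<and> g z = 0}" "f \<longlonglongrightarrow> l"
      then have "(\<lambda>n. g (f n)) \<longlonglongrightarrow> g l" by (intro lim) auto
      then have "g l = 0" using f(1) by (simp add: LIMSEQ_const_iff)
      then show "l \<in> {z. z \<in> R \<and> g z = 0}"
        using f closed_sequentially[OF closed_R, of f l] by auto
    qed
    have "g 0 = 0" using g(1)[OF R_0 R_0] by simp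
    then show "csubspace {z. z \<in> R \<and> g z = 0}"
      by (intro complex_vector.subspaceI) (auto simp: g R_0 R_add R_scaleC)
  qed (simp add: R_gen gen)
  then show ?thesis by simp
qed

text \<open>On generators \<open>y\<close> this is the defining property of \<open>tau_rel\<close>;
  density does the rest.\<close>

lemma tau_centralizer:
  assumes "x \<in> R" "y \<in> R"
  shows "tau x * y = x * tau y"
proof -
  have "tau x * y - x * tau y = 0"
  proof (rule R_eq_induct[OF assms(2), where g = "\<lambda>y. tau x * y - x * tau y"])
    show "tau x * (m * adj n) - x * tau (m * adj n) = 0" if "m \<in> M" "n \<in> M" for m n
      using tau_rel_tau[OF assms(1)] that by (simp add: tau_gen tau_rel_def)
    show "(\<lambda>n. tau x * f n - x * tau (f n)) \<longlonglongrightarrow> tau x * z - x * tau z"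
      if "\<And>n. f n \<in> R" "f \<longlonglongrightarrow> z" for f z
      by (intro tendsto_intros tau_tendsto(2) that)
  qed (simp_all add: tau_add tau_scaleC mult_scaleC_right algebra_simps)
  then show ?thesis by simp
qed

lemma tau_mult_left: "x \<in> R \<Longrightarrow> y \<in> R \<Longrightarrow> tau (x * y) = tau x * y"
  by (simp add: tau_mult_right tau_centralizer)

lemma tau_adj:
  assumes "x \<in> R"
  shows "tau (adj x) = adj (tau x)"
proof -
  have "tau (adj x) - adj (tau x) = 0"
  proof (rule R_eq_induct[OF assms, where g = "\<lambda>x. tau (adj x) - adj (tau x)"])
    show "(\<lambda>n. tau (adj (f n)) - adj (tau (f n))) \<longlonglongrightarrow> tau (adj z) - adj (tau z)"
      if "\<And>n. f n \<in> R" "f \<longlonglongrightarrow> z" for f z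
      by (intro tendsto_intros tau_tendsto(2) that R_adj)
    show "tau (adj (m * adj n)) - adj (tau (m * adj n)) = 0" if "m \<in> M" "n \<in> M" for m n
      using that by (simp add: adj_mult adj_adj tau_gen P_adj)
  qed (simp_all add: tau_add tau_scaleC adj_add adj_scaleC R_adj)
  then show ?thesis by simp
qed

section \<open>The double centralizer and its characterization\<close>

definition multiplier :: "'a double_centralizer" where
  "multiplier = DC (restrict tau R) (restrict tau R)"

lemma multiplier_in: "multiplier \<in> multiplier_algebra R"
  unfolding multiplier_def
  by (rule diagonal_multiplier[where K = 1])
    (auto intro: tau_in_R tau_mult_left tau_mult_right R_mult csubspace_R simp: tau_add tau_scaleC tau_norm)

lemma R_cancel:
  assumes "x \<in> R" "y \<in> R" "\<And>z. z \<in> R \<Longrightarrow> z * x = z * y"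
  shows "x = y"
proof -
  have "adj (x - y) * (x - y) = 0"
    using assms(3)[OF R_adj[OF R_diff[OF assms(1,2)]]] by (simp add: right_diff_distrib)
  from adj_mult_self_eq_0D[OF this] show ?thesis by simp
qed

lemma R_cancel':
  assumes "x \<in> R" "y \<in> R" "\<And>z. z \<in> R \<Longrightarrow> x * z = y * z"
  shows "x = y"
proof -
  have "adj x = adj y"
  proof (rule R_cancel)
    show "z * adj x = z * adj y" if "z \<in> R" for z
      using arg_cong[OF assms(3)[OF R_adj[OF that]], of adj] by (simp add: adj_mult adj_adj)
  qed (simp_all add: R_adj assms)
  then show ?thesis by (metis adj_adj)
qed

text \<open>Multiplying by \<open>z\<close> lets \<open>tau\<close> jump across the product: S(tau
  x) z = S(x tau z) = S(x) tau z = tau(S x) z. Cancelling \<open>z\<close> leaves commutation,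
  without any commutativity in the ideal.\<close>

lemma multiplier_central: "dc_central R multiplier"
  unfolding dc_central_def
proof
  fix S assume "S \<in> multiplier_algebra R"
  then have S_in: "\<And>x. x \<in> R \<Longrightarrow> lmult S x \<in> R" "\<And>x. x \<in> R \<Longrightarrow> rmult S x \<in> R"
    and S: "\<And>x y. x \<in> R \<Longrightarrow> y \<in> R \<Longrightarrow> lmult S (x * y) = lmult S x * y"
      "\<And>x y. x \<in> R \<Longrightarrow> y \<in> R \<Longrightarrow> rmult S (x * y) = x * rmult S y"
    by (auto simp: multiplier_algebra_def)
  have "tau (lmult S x) = lmult S (tau x)" if x: "x \<in> R" for x
  proof (rule R_cancel')
    fix z assume z: "z \<in> R"
    have "lmult S (tau x) * z = lmult S (x * tau z)"
      using x z by (simp add: S(1)[symmetric] tau_in_R tau_centralizer)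
    also have "\<dots> = tau (lmult S x) * z"
      using x z by (simp add: S(1) tau_in_R S_in tau_centralizer)
    finally show "tau (lmult S x) * z = lmult S (tau x) * z" ..
  qed (use x in \<open>simp_all add: tau_in_R S_in\<close>)
  moreover have "tau (rmult S x) = rmult S (tau x)" if x: "x \<in> R" for x
  proof (rule R_cancel)
    fix z assume z: "z \<in> R"
    have "z * rmult S (tau x) = rmult S (tau z * x)"
      using x z by (simp add: S(2)[symmetric] tau_in_R tau_centralizer)
    also have "\<dots> = tau z * rmult S x"
      using x z by (intro S(2) tau_in_R)
    also have "\<dots> = z * tau (rmult S x)"
      using x z by (intro tau_centralizer S_in)
    finally show "z * tau (rmult S x) = z * rmult S (tau x)" ..
  qed (use x in \<open>simp_all add: tau_in_R S_in\<close>)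
  ultimately show "dc_mult R multiplier S = dc_mult R S multiplier"
    by (auto simp: dc_mult_def multiplier_def S_in tau_in_R intro!: restrict_ext)
qed

lemma multiplier_norm: "dc_norm R multiplier \<le> 1"
  unfolding dc_norm_def
proof (rule cSUP_least)
  show "{x \<in> R. norm x \<le> 1} \<noteq> {}" using R_0 by force
  show "norm (lmult multiplier x) \<le> 1" if "x \<in> {x \<in> R. norm x \<le> 1}" for x
    using that tau_norm[of x] by (simp add: multiplier_def)
qed

lemma multiplier_positive: "dc_positive R multiplier"
proof -
  define V where "V x = x - tau x" for x
  interpret V: contraction_on R V
  proof
    show "V (c *\<^sub>R x) = c *\<^sub>R V x" if "x \<in> R" for c x
      using that by (simp add: V_def scaleR_scaleC tau_scaleC complex_vector.scale_right_diff_distrib)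
  qed (auto simp: V_def closed_R csubspace_imp_subspace csubspace_R R_diff tau_in_R tau_diff tau_complement_norm)
  let ?S = "sqrt_series V"
  \<comment> \<open>Multiplications by elements of \<open>R\<close>, complex scalars and
    \<open>adj\<close> commute with \<open>V\<close>, hence with the series; this makes the root a
    self-adjoint multiplier.\<close>
  have S_right: "?S (x * y) = x * ?S y" if "x \<in> R" "y \<in> R" for x y
    using that
    by (intro V.sqrt_series_commute[symmetric] bounded_linear_mult_right)
      (auto simp: V_def right_diff_distrib tau_mult_right R_mult)
  have S_left: "?S (x * y) = ?S x * y" if "x \<in> R" "y \<in> R" for x y
    using that
    by (intro V.sqrt_series_commute[symmetric, where W = "\<lambda>z. z * y"] bounded_linear_mult_left)
      (auto simp: V_def left_diff_distrib tau_mult_left R_mult)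
  have S_scaleC: "?S (c *\<^sub>C x) = c *\<^sub>C ?S x" if "x \<in> R" for c x
    using that
    by (intro V.sqrt_series_commute[symmetric] bounded_linear_scaleC)
      (auto simp: V_def complex_vector.scale_right_diff_distrib tau_scaleC R_scaleC)
  have S_adj: "?S (adj x) = adj (?S x)" if "x \<in> R" for x
    using that
    by (intro V.sqrt_series_commute[symmetric] bounded_linear_adj)
      (auto simp: V_def adj_diff tau_adj R_adj)
  have S_square: "?S (?S x) = tau x" if "x \<in> R" for x
    using V.sqrt_series_sqrt_series[OF that] by (simp add: V_def)
  define T where "T = DC (restrict ?S R) (restrict ?S R)"
  have "T \<in> multiplier_algebra R"
    unfolding T_def
    by (rule diagonal_multiplier[OF V.sqrt_series_in V.sqrt_series_add S_scaleC V.sqrt_series_norm S_left S_right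
          csubspace_R R_mult])
  moreover have "multiplier = dc_mult R (dc_adj R T) T"
    by (auto simp: multiplier_def dc_mult_def dc_adj_def T_def R_adj V.sqrt_series_in S_adj adj_adj S_square
        intro!: restrict_ext)
  ultimately show ?thesis unfolding dc_positive_def by blast
qed

text \<open>Boundedness extends agreement of the left halves from generators to \<open>R\<close>;
  the right half is then determined by \<open>rmult x * z = x * lmult z\<close> and
  cancellation.\<close>

lemma multiplier_unique:
  assumes \<sigma>: "\<sigma> \<in> multiplier_algebra R"
    and gen: "\<And>m n. m \<in> M \<Longrightarrow> n \<in> M \<Longrightarrow> lmult \<sigma> (m * adj n) = P m * P (adj n)"
  shows "\<sigma> = multiplier"
proof -
  have \<sigma>_in: "lmult \<sigma> \<in> R \<rightarrow>\<^sub>E R" "rmult \<sigma> \<in> R \<rightarrow>\<^sub>E R"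
    and comm: "\<And>x y. x \<in> R \<Longrightarrow> y \<in> R \<Longrightarrow> rmult \<sigma> x * y = x * lmult \<sigma> y"
    and add: "\<And>x y. x \<in> R \<Longrightarrow> y \<in> R \<Longrightarrow> lmult \<sigma> (x + y) = lmult \<sigma> x + lmult \<sigma> y"
    and scaleC: "\<And>x c. x \<in> R \<Longrightarrow> lmult \<sigma> (c *\<^sub>C x) = c *\<^sub>C lmult \<sigma> x"
    using \<sigma> by (auto simp: multiplier_algebra_def bounded_clinear_on_def)
  have "\<exists>K. \<forall>x\<in>R. norm (lmult \<sigma> x) \<le> K * norm x"
    using \<sigma> by (simp add: multiplier_algebra_def bounded_clinear_on_def)
  then obtain K where K: "\<And>x. x \<in> R \<Longrightarrow> norm (lmult \<sigma> x) \<le> K * norm x"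
    by blast
  have diff: "lmult \<sigma> (x - y) = lmult \<sigma> x - lmult \<sigma> y" if "x \<in> R" "y \<in> R" for x y
    using add[OF R_diff[OF that] that(2)] by simp
  have lim: "(\<lambda>n. lmult \<sigma> (f n)) \<longlonglongrightarrow> lmult \<sigma> z" if f: "\<And>n. f n \<in> R" "f \<longlonglongrightarrow> z" for f z
  proof -
    have z: "z \<in> R" using tau_tendsto(1)[OF f] .
    have "(\<lambda>n. lmult \<sigma> (f n - z)) \<longlonglongrightarrow> 0"
    proof (rule Lim_null_comparison)
      show "\<forall>\<^sub>F n in sequentially. norm (lmult \<sigma> (f n - z)) \<le> K * norm (f n - z)"
        by (intro always_eventually allI K R_diff f z)
      show "(\<lambda>n. K * norm (f n - z)) \<longlonglongrightarrow> 0"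
        using f(2) by (simp add: LIM_zero tendsto_norm_zero tendsto_mult_right_zero)
    qed
    then show ?thesis by (simp add: diff f z LIM_zero_cancel)
  qed
  have l: "lmult \<sigma> x = tau x" if "x \<in> R" for x
  proof -
    have "lmult \<sigma> x - tau x = 0"
      by (rule R_eq_induct[OF that, where g = "\<lambda>x. lmult \<sigma> x - tau x"])
        (simp_all add: add scaleC tau_add tau_scaleC gen tau_gen tendsto_diff lim tau_tendsto(2))
    then show ?thesis by simp
  qed
  have r: "rmult \<sigma> x = tau x" if "x \<in> R" for x
  proof (rule R_cancel')
    show "rmult \<sigma> x * z = tau x * z" if "z \<in> R" for z
      using \<open>x \<in> R\<close> that by (simp add: comm l tau_centralizer)
  qed (use \<sigma>_in that in \<open>auto simp: tau_in_R\<close>)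
  have "lmult \<sigma> = restrict tau R" "rmult \<sigma> = restrict tau R"
    using \<sigma>_in l r by (auto simp: fun_eq_iff PiE_def extensional_def)
  then show ?thesis
    by (metis multiplier_def double_centralizer.collapse)
qed

section \<open>Strict convergence along a frame\<close>

context
  fixes u :: "nat \<Rightarrow> 'a"
  assumes u: "frame M u"
begin

definition frame_sum :: "nat set \<Rightarrow> 'a" where
  "frame_sum I = (\<Sum>i\<in>I. u i * adj (u i))"

lemma u_in: "u i \<in> M"
  using u by (auto simp: frame_def)

lemma frame_sum_in: "frame_sum I \<in> R"
  unfolding frame_sum_def
  by (rule complex_vector.subspace_sum[OF csubspace_R]) (simp add: R_gen u_in)

lemma frame_sum_in_R0: "frame_sum I \<in> R\<^sub>0"
  unfolding frame_sum_def
  by (intro complex_vector.span_sum complex_vector.span_base) (use u_in in blast)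

lemma adj_frame_sum: "adj (frame_sum I) = frame_sum I"
  by (simp add: frame_sum_def adj_sum adj_mult adj_adj)

lemma psd_frame_sum: "psd (frame_sum I)"
  unfolding frame_sum_def by (intro psd_sum psd_mult_adj)

lemma frame_sum_mult_R0:
  assumes "r \<in> R\<^sub>0"
  shows "((\<lambda>I. frame_sum I * r) \<longlongrightarrow> r) (finite_subsets_at_top UNIV)"
proof (rule R0_induct[OF assms])
  show "csubspace {r. ((\<lambda>I. frame_sum I * r) \<longlongrightarrow> r) (finite_subsets_at_top UNIV)}"
    by (rule complex_vector.subspaceI)
      (auto simp: distrib_left mult_scaleC_right intro: tendsto_add bounded_linear.tendsto[OF bounded_linear_scaleC])
  fix m n assume "m \<in> M" "n \<in> M"
  then have "((\<lambda>I. frame_sum I * m) \<longlongrightarrow> m) (finite_subsets_at_top UNIV)"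
    using u by (simp add: frame_def has_sum_def frame_sum_def sum_distrib_right)
  then have "((\<lambda>I. frame_sum I * m * adj n) \<longlongrightarrow> m * adj n) (finite_subsets_at_top UNIV)"
    by (intro tendsto_intros)
  then show "((\<lambda>I. frame_sum I * (m * adj n)) \<longlongrightarrow> m * adj n) (finite_subsets_at_top UNIV)"
    by (simp add: mult.assoc)
qed

text \<open>The partial sums \<open>p\<close> increase, so \<open>r\<^sup>* p r \<le> r\<^sup>* r\<close> in the limit; for \<open>r = p\<close> this gives
  \<open>\<parallel>p\<parallel>\<^sup>3 \<le> \<parallel>p\<parallel>\<^sup>2\<close>.\<close>

lemma norm_frame_sum_le:
  assumes "finite I"
  shows "norm (frame_sum I) \<le> 1"
proof -
  define p where "p = frame_sum I"
  have p: "adj p = p" "p \<in> R\<^sub>0" by (simp_all add: p_def adj_frame_sum frame_sum_in_R0)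
  have "((\<lambda>J. norm (p * (frame_sum J * p))) \<longlongrightarrow> norm (p * p)) (finite_subsets_at_top UNIV)"
    by (intro tendsto_intros frame_sum_mult_R0 p)
  moreover have "norm (p * (p * p)) \<le> norm (p * (frame_sum J * p))" if "finite J" "I \<subseteq> J" for J
  proof -
    have "frame_sum J = p + frame_sum (J - I)"
      unfolding frame_sum_def p_def using that by (metis sum.subset_diff add.commute)
    then have "p * (frame_sum J * p) = adj p * p * p + adj p * frame_sum (J - I) * p"
      by (simp add: p algebra_simps)
    moreover have "norm (adj p * p * p) \<le> norm (adj p * p * p + adj p * frame_sum (J - I) * p)"
      by (intro psd_norm_mono psd_conj psd_frame_sum) (simp add: p_def psd_frame_sum)
    ultimately show ?thesis by (simp add: p mult.assoc)
  qed
  then have "\<forall>\<^sub>F J in finite_subsets_at_top UNIV. norm (p * (p * p)) \<le> norm (p * (frame_sum J * p))"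
    using assms by (auto simp: eventually_finite_subsets_at_top)
  ultimately have "norm (p * (p * p)) \<le> norm (p * p)"
    by (rule tendsto_lowerbound) simp
  then have 1: "norm (p * (p * p)) \<le> (norm p)\<^sup>2"
    by (simp add: norm_square_selfadjoint p)
  have "(norm p)\<^sup>2 * (norm p)\<^sup>2 = norm (p * (p * (p * p)))"
    using norm_square_selfadjoint[of "p * p"] norm_square_selfadjoint[of p]
    by (simp add: p adj_mult mult.assoc power2_eq_square)
  also have "\<dots> \<le> norm p * (norm p)\<^sup>2"
    by (rule order_trans[OF norm_mult_ineq mult_left_mono[OF 1]]) simp
  finally have "norm p * (norm p)\<^sup>2 * norm p \<le> norm p * (norm p)\<^sup>2 * 1"
    by (simp add: power2_eq_square mult_ac)
  then show ?thesis
    by (cases "p = 0") (simp_all add: p_def)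
qed

text \<open>The frame identity gives convergence on the span only; the uniform bound on the partial
  sums carries it to the closure.\<close>

lemma frame_sum_mult_R:
  assumes "r \<in> R"
  shows "((\<lambda>I. frame_sum I * r) \<longlongrightarrow> r) (finite_subsets_at_top UNIV)"
  unfolding tendsto_iff
proof (intro allI impI)
  fix \<epsilon> :: real assume "\<epsilon> > 0"
  then obtain s where s: "s \<in> R\<^sub>0" "dist s r < \<epsilon> / 3"
    using assms unfolding slice_range_def closure_approachable by (meson divide_pos_pos zero_less_numeral)
  have "\<forall>\<^sub>F I in finite_subsets_at_top UNIV. dist (frame_sum I * s) s < \<epsilon> / 3"
    by (rule tendstoD[OF frame_sum_mult_R0[OF s(1)]]) (simp add: \<open>\<epsilon> > 0\<close>)
  moreover have "\<forall>\<^sub>F I in finite_subsets_at_top (UNIV :: nat set). finite I"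
    by (rule eventually_finite_subsets_at_top_weakI)
  ultimately show "\<forall>\<^sub>F I in finite_subsets_at_top UNIV. dist (frame_sum I * r) r < \<epsilon>"
  proof eventually_elim
    case (elim I)
    have "dist (frame_sum I * r) (frame_sum I * s) \<le> norm (frame_sum I) * norm (r - s)"
      using norm_mult_ineq[of "frame_sum I" "r - s"] by (simp add: dist_norm right_diff_distrib)
    also have "\<dots> \<le> dist s r"
      using norm_frame_sum_le[OF elim(2)]
      by (simp add: dist_norm norm_minus_commute mult_left_le_one_le)
    finally show ?case
      using elim(1) s(2) dist_triangle[of "frame_sum I * r" r "frame_sum I * s"]
        dist_triangle[of "frame_sum I * s" r s] by linarith
  qed
qed

lemma mult_frame_sum_R:
  assumes "r \<in> R"
  shows "((\<lambda>I. r * frame_sum I) \<longlongrightarrow> r) (finite_subsets_at_top UNIV)"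
  using tendsto_adj[OF frame_sum_mult_R[OF R_adj[OF assms]]]
  by (simp add: adj_mult adj_adj adj_frame_sum)

lemma tau_frame_sum:
  assumes "finite I"
  shows "tau (frame_sum I) = (\<Sum>i\<in>I. P (u i) * P (adj (u i)))"
proof -
  have "tau_rel (\<Sum>i\<in>I. u i * adj (u i)) (\<Sum>i\<in>I. P (u i) * P (adj (u i)))"
    using assms by (induction I) (auto simp: tau_rel_0 intro!: tau_rel_add tau_rel_gen u_in)
  then show ?thesis unfolding frame_sum_def by (rule tau_eq)
qed

text \<open>Each partial sum is \<open>tau (frame_sum I)\<close>, and the centralizer identity
  shifts \<open>tau\<close> onto the argument. So the claim is convergence of
  \<open>frame_sum I\<close> to the identity at the fixed element \<open>tau a\<close>, from either
  side.\<close>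

lemma multiplier_limitin:
  "limitin (strict_topology R)
    (\<lambda>I. dc_embed R (\<Sum>i\<in>I. P (u i) * P (adj (u i)))) multiplier (finite_subsets_at_top UNIV)"
proof (rule limitin_strict_topology[OF multiplier_in _ _ _ R_0])
  let ?t = "\<lambda>I. \<Sum>i\<in>I. P (u i) * P (adj (u i))"
  have "?t I \<in> R" for I
    by (rule complex_vector.subspace_sum[OF csubspace_R]) (simp add: R_mult P_in_R P_adj_in_R u_in)
  then show "dc_embed R (?t I) \<in> multiplier_algebra R" for I
    by (rule dc_embed_multiplier[OF _ csubspace_R R_mult])
  fix a assume a: "a \<in> R"
  have fin: "\<forall>\<^sub>F I in finite_subsets_at_top (UNIV :: nat set). finite I"
    by (rule eventually_finite_subsets_at_top_weakI)
  have "\<forall>\<^sub>F I in finite_subsets_at_top UNIV. frame_sum I * tau a = lmult (dc_embed R (?t I)) a"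
    using fin by eventually_elim
      (simp add: dc_embed_def a tau_frame_sum[symmetric] tau_centralizer frame_sum_in)
  moreover have "((\<lambda>I. frame_sum I * tau a) \<longlongrightarrow> lmult multiplier a) (finite_subsets_at_top UNIV)"
    using frame_sum_mult_R[OF tau_in_R[OF a]] by (simp add: multiplier_def a)
  ultimately show "((\<lambda>I. lmult (dc_embed R (?t I)) a) \<longlongrightarrow> lmult multiplier a) (finite_subsets_at_top UNIV)"
    by (rule Lim_transform_eventually[rotated])
  have "\<forall>\<^sub>F I in finite_subsets_at_top UNIV. tau a * frame_sum I = rmult (dc_embed R (?t I)) a"
    using fin by eventually_elim
      (simp add: dc_embed_def a tau_frame_sum[symmetric] tau_centralizer frame_sum_in)
  moreover have "((\<lambda>I. tau a * frame_sum I) \<longlongrightarrow> rmult multiplier a) (finite_subsets_at_top UNIV)"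
    using mult_frame_sum_R[OF tau_in_R[OF a]] by (simp add: multiplier_def a)
  ultimately show "((\<lambda>I. rmult (dc_embed R (?t I)) a) \<longlongrightarrow> rmult multiplier a) (finite_subsets_at_top UNIV)"
    by (rule Lim_transform_eventually[rotated])
qed

end

end

theorem lemma11p5:
  fixes B M R :: "'a::cstar_algebra set" and P :: "'a \<Rightarrow> 'a"
  defines "R \<equiv> slice_range M"
  assumes "separable_space (euclidean :: 'a topology)"
    and "closed_star_subalgebra B"
    and "contains_approximate_unit B"
    and "conditional_expectation B P"
    and "slice B M"
  shows "\<exists>\<tau>.
    (\<tau> \<in> multiplier_algebra R \<and> dc_central R \<tau> \<and> dc_positive R \<tau> \<and> dc_norm R \<tau> \<le> 1 \<and>
      (\<forall>m\<in>M. \<forall>n\<in>M. lmult \<tau> (m * adj n) = P m * P (adj n))) \<and>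
    (\<forall>\<sigma>. \<sigma> \<in> multiplier_algebra R \<and> dc_central R \<sigma> \<and> dc_positive R \<sigma> \<and> dc_norm R \<sigma> \<le> 1 \<and>
      (\<forall>m\<in>M. \<forall>n\<in>M. lmult \<sigma> (m * adj n) = P m * P (adj n)) \<longrightarrow> \<sigma> = \<tau>) \<and>
    (\<forall>u. frame M u \<longrightarrow>
      limitin (strict_topology R)
        (\<lambda>I. dc_embed R (\<Sum>i\<in>I. P (u i) * P (adj (u i)))) \<tau> (finite_subsets_at_top UNIV))"
proof -
  interpret slice_expectation B M P
    by unfold_locales fact+
  have "lmult multiplier (m * adj n) = P m * P (adj n)" if "m \<in> M" "n \<in> M" for m n
    using that by (simp add: multiplier_def R_gen tau_gen)
  then show ?thesis
    unfolding R_def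
    by (intro exI[of _ multiplier])
      (simp add: multiplier_in multiplier_central multiplier_positive multiplier_norm multiplier_unique multiplier_limitin)
qed

end
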